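(* For all integers $\ell \geq 1$ and $k\geq 9\ell^2 - 3\ell +1$, every $2$-connected graph $G$ with a $\Gamma_k$ minor contains $\Gamma_{\ell}^{+}$ or $\nabla_\ell$ as a minor.
   Context: All graphs are finite and simple. For $\ell\ge 0$, $\Gamma_\ell$ denotes the complete binary tree of height $\ell$: the rooted tree in which every non-leaf vertex has exactly two children, with $2^\ell$ leaves and every root-to-leaf path having exactly $\ell$ edges. $\Gamma_\ell^+$ is obtained from $\Gamma_\ell$ by adding one new vertex adjacent to all leaves of $\Gamma_\ell$. The graphs $\nabla_\ell$ ($\ell\ge1$), each with a designated root edge, are defined recursively: $\nabla_1$ is a triangle with one edge designated as root edge; $\nabla_{\ell+1}$ is obtained by taking two disjoint copies of $\nabla_\ell$ with root edges $e_1,e_2$ and a triangle with edges $e_1',e_2',e_3$, identifying $e_i$ with $e_i'$ for $i=1,2$, and declaring $e_3$ the root edge. *)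

theory Defs
  imports "Graph_Theory.Graph_Theory" "HOL-Library.Disjoint_Sets"
begin

text \<open>
  A finite simple graph is a \<^locale>\<open>pair_graph\<close>: a finite, symmetric, loop-free set of arcs,
  an undirected edge \<open>uv\<close> being the pair of arcs \<open>(u, v)\<close>, \<open>(v, u)\<close>.
  Connected graphs are non-empty in \<open>Graph_Theory\<close>.
\<close>

definition k_connected :: "nat \<Rightarrow> 'a pair_pre_digraph \<Rightarrow> bool" where
  "k_connected k G \<longleftrightarrow>
     card (pverts G) > k \<and>
     (\<forall>X. X \<subseteq> pverts G \<and> card X < k \<longrightarrow> connected (with_proj G \<restriction> (pverts G - X)))"

text \<open>
  \<open>B\<close> is a model of \<open>H\<close> in \<open>G\<close>: deleting everything outside the branch sets \<open>B v\<close>, contracting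
  each of them to a single vertex and deleting surplus edges yields a copy of \<open>H\<close>.
\<close>

definition minor_model :: "('b \<Rightarrow> 'a set) \<Rightarrow> 'b pair_pre_digraph \<Rightarrow> 'a pair_pre_digraph \<Rightarrow> bool" where
  "minor_model B H G \<longleftrightarrow>
     (\<forall>v \<in> pverts H. B v \<subseteq> pverts G \<and> connected (with_proj G \<restriction> B v)) \<and>
     disjoint_family_on B (pverts H) \<and>
     (\<forall>(u, v) \<in> parcs H. \<exists>x \<in> B u. \<exists>y \<in> B v. (x, y) \<in> parcs G)"

definition is_minor :: "'b pair_pre_digraph \<Rightarrow> 'a pair_pre_digraph \<Rightarrow> bool" where
  "is_minor H G \<longleftrightarrow> (\<exists>B. minor_model B H G)"

text \<open>
  A vertex of the complete binary tree is the list of left/right choices leading to it, most recent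
  choice first; the root is \<open>[]\<close> and the children of \<open>xs\<close> are \<open>False # xs\<close> and \<open>True # xs\<close>.
\<close>

definition binary_tree :: "nat \<Rightarrow> bool list pair_pre_digraph" where
  "binary_tree l =
     \<lparr> pverts = {xs. length xs \<le> l},
       parcs = {(xs, ys). length xs \<le> l \<and> length ys \<le> l \<and> (\<exists>b. ys = b # xs \<or> xs = b # ys)} \<rparr>"

definition binary_tree_leaves :: "nat \<Rightarrow> bool list set" where
  "binary_tree_leaves l = {xs. length xs = l}"

text \<open>The added vertex is \<^term>\<open>None\<close>.\<close>

definition binary_tree_plus :: "nat \<Rightarrow> bool list option pair_pre_digraph" where
  "binary_tree_plus l =
     \<lparr> pverts = insert None (Some ` pverts (binary_tree l)),
       parcs = map_prod Some Some ` parcs (binary_tree l) \<union>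
         {(None, Some x) | x. x \<in> binary_tree_leaves l} \<union>
         {(Some x, None) | x. x \<in> binary_tree_leaves l} \<rparr>"

text \<open>
  \<open>nabla l\<close> has vertex set \<open>{0..2 ^ l}\<close> and root edge \<open>{0, 2 ^ l}\<close>. With \<open>d = 2 ^ Suc l\<close>, the two
  copies of \<open>nabla (Suc l)\<close> are \<open>nabla (Suc l)\<close> itself and its translate by \<open>d\<close>; they share just the
  vertex \<open>d\<close>. Their root edges \<open>{0, d}\<close> and \<open>{d, 2 * d}\<close> are two edges of the triangle
  \<open>{0, d, 2 * d}\<close>, whose third edge \<open>{0, 2 * d}\<close> is added as the new root edge. It is immaterial
  which way round the root edges are glued, as \<open>x \<mapsto> 2 ^ l - x\<close> is an automorphism of \<open>nabla l\<close>.
  The value at \<open>0\<close> is a convention without significance.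
\<close>

fun nabla :: "nat \<Rightarrow> nat pair_pre_digraph" where
  "nabla 0 = \<lparr> pverts = {0, 1}, parcs = {(0, 1), (1, 0)} \<rparr>"
| "nabla (Suc 0) =
     \<lparr> pverts = {0, 1, 2}, parcs = {(0, 1), (1, 0), (1, 2), (2, 1), (0, 2), (2, 0)} \<rparr>"
| "nabla (Suc (Suc l)) =
     (let N = nabla (Suc l); d = 2 ^ Suc l in
      \<lparr> pverts = pverts N \<union> (\<lambda>x. x + d) ` pverts N,
        parcs = parcs N \<union> map_prod (\<lambda>x. x + d) (\<lambda>x. x + d) ` parcs N \<union>
          {(0, 2 * d), (2 * d, 0)} \<rparr>)"


lemma pair_graphI:
  assumes "finite (pverts G)"
    and "\<And>u v. (u, v) \<in> parcs G \<Longrightarrow> u \<in> pverts G \<and> u \<noteq> v \<and> (v, u) \<in> parcs G"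
  shows "pair_graph G"
proof -
  have ends: "fst e \<in> pverts G" "snd e \<in> pverts G" "fst e \<noteq> snd e" if "e \<in> parcs G" for e
    using assms(2)[of "fst e" "snd e"] assms(2)[of "snd e" "fst e"] that by simp_all
  then have "parcs G \<subseteq> pverts G \<times> pverts G"
    by (simp add: subset_iff mem_Times_iff del: split_paired_All)
  then have "finite (parcs G)"
    using assms(1) by (meson finite_SigmaI finite_subset)
  moreover have "symmetric (with_proj G)"
    using assms(2) unfolding symmetric_def sym_def with_proj_simps by iprover
  ultimately show ?thesis
    using assms(1) ends by unfold_locales
qed

lemma finite_lists_le: "finite {xs :: bool list. length xs \<le> l}"
  using finite_lists_length_le[of "UNIV :: bool set" l] by simp

lemma pair_graph_binary_tree: "pair_graph (binary_tree l)"
  by (rule pair_graphI) (auto simp: binary_tree_def finite_lists_le)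

lemma card_binary_tree_leaves: "card (binary_tree_leaves l) = 2 ^ l"
  using card_lists_length_eq[of "UNIV :: bool set" l] by (simp add: binary_tree_leaves_def)

lemma pair_graph_binary_tree_plus: "pair_graph (binary_tree_plus l)"
  by (rule pair_graphI)
    (auto simp: binary_tree_plus_def binary_tree_def binary_tree_leaves_def finite_lists_le)

lemma pverts_nabla: "pverts (nabla l) = {0..2 ^ l}"
proof (induction l rule: nabla.induct)
  case (3 l)
  define d :: nat where "d = 2 ^ Suc l"
  have "pverts (nabla (Suc (Suc l))) = {0..d} \<union> (\<lambda>x. x + d) ` {0..d}"
    using 3 by (simp add: Let_def d_def del: power_Suc)
  also have "\<dots> = {0..d + d}"
    by (auto simp: image_iff intro: bexI[of _ "_ - d"])
  also have "d + d = 2 ^ Suc (Suc l)"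
    by (simp add: d_def)
  finally show ?case .
qed auto

lemma nabla_root_edge: "(0, 2 ^ l) \<in> parcs (nabla l)"
  by (induction l rule: nabla.induct) (auto simp: Let_def)

lemma pair_graph_nabla: "pair_graph (nabla l)"
proof (rule pair_graphI)
  show "finite (pverts (nabla l))"
    by (simp add: pverts_nabla)
next
  fix u v assume "(u, v) \<in> parcs (nabla l)"
  then show "u \<in> pverts (nabla l) \<and> u \<noteq> v \<and> (v, u) \<in> parcs (nabla l)"
  proof (induction l arbitrary: u v rule: nabla.induct)
    case (3 l)
    let ?d = "2 ^ Suc l"
    from "3.prems" consider "(u, v) \<in> parcs (nabla (Suc l))"
      | x y where "u = x + ?d" "v = y + ?d" "(x, y) \<in> parcs (nabla (Suc l))"
      | "(u, v) \<in> {(0, 2 * ?d), (2 * ?d, 0)}"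
      by (auto simp: Let_def simp del: power_Suc)
    then show ?case
    proof cases
      case 1
      from "3.IH"[OF this] show ?thesis
        by (simp add: Let_def)
    next
      case 2
      from "3.IH"[OF this(3)] 2(1,2) show ?thesis
        by (force simp: Let_def simp del: power_Suc)
    next
      case 3
      then show ?thesis
        by (auto simp: Let_def pverts_nabla image_iff)
    qed
  qed auto
qed

end

theory Submission
  imports Defs "HOL-Library.Sublist"
begin

text \<open>
  Extend the branch sets of the binary tree to a partition of the vertex set and let \<open>U v\<close> be the
  union of the branch sets in the subtree below \<open>v\<close>. Since the complement of \<open>U v\<close> is connected,
  contracting it shows: without a \<open>\<Gamma>\<^sub>l\<^sup>+\<close> minor, some \<open>w\<close> at distance \<open>l\<close> below \<open>v\<close> has all neighbours
  of \<open>U w\<close> inside \<open>U v\<close>.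

  Consider disjoint connected sets \<open>r\<close>, \<open>s\<close> that contain all outside neighbours of \<open>U x\<close>. Going down at most
  \<open>2 l + 1\<close> levels, there are nodes \<open>y\<close>, \<open>z\<close> below \<open>x\<close> such that the rest of \<open>U x\<close> can be distributed so that
  \<open>U y\<close> and \<open>U z\<close> are again attached to exactly two connected sets each, either in series between \<open>r\<close>
  and \<open>s\<close> (which adds one level to a \<open>\<nabla>\<close> with root edge \<open>r s\<close>), or in parallel, both attached to the same
  two sets, one of which branches off \<open>r\<close> or \<open>s\<close> (which adds one level to a binary tree with apex \<open>s\<close> or \<open>r\<close>).
  After \<open>3 l - 2\<close> such steps one of the three structures has height \<open>l\<close>.
\<close>

section \<open>Connected sets and disjoint paths\<close>

text \<open>A subtree \<open>U w\<close> may have neighbours all over the graph, and two disjoint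
  attachment sets can only be extracted where something surrounds it. So every subtree in use comes
  with a ring, taken from a larger subtree that encloses it, and 2-connectedness is spent on
  splitting rings. One ring suffices to place two subtrees in parallel. In series it only gives a
  chain \<open>A\<close>, \<open>M\<close>, \<open>C\<close>: consecutive sets need not touch each
  other, and a subtree may also touch the third set. Splitting a second ring into two touching
  halves repairs both. Hence \<open>2 * l + 1\<close> levels: one to reach two disjoint subtrees and
  \<open>l\<close> for each enclosure.

  The number of steps is an additive pigeonhole count. Targets \<open>h\<close>, \<open>i\<close>,
  \<open>j\<close> for the nabla and the two trees are kept apart, each step lowers one of them, and
  target 0 is free. Three positive targets sum to at least 3, so
  \<open>h + i + j \<le> n + 2\<close> suffices for \<open>n\<close> steps;
  \<open>3 * l = n + 2\<close> gives \<open>3 * l - 2\<close>. Both orientations of trees occur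
  because a fan step may hang its new node from \<open>r\<close> or from \<open>s\<close>.\<close>

locale symmetric_relation =
  fixes E :: "('a \<times> 'a) set"
  assumes sym_E: "sym E"
begin

definition touch :: "'a set \<Rightarrow> 'a set \<Rightarrow> bool" where
  "touch S T \<longleftrightarrow> (\<exists>x \<in> S. \<exists>y \<in> T. (x, y) \<in> E)"

text \<open>Connectedness in cut form, so that unions and subsets can be handled without walks.
  \<open>conn_iff_rtrancl_on\<close> links it with reachability; the empty set is excluded as in the
  library.\<close>

definition conn :: "'a set \<Rightarrow> bool" where
  "conn S \<longleftrightarrow> S \<noteq> {} \<and> (\<forall>P. P \<subset> S \<and> P \<noteq> {} \<longrightarrow> touch P (S - P))"

lemma touch_commute: "touch S T \<longleftrightarrow> touch T S"
  using sym_E unfolding touch_def sym_def by blast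

lemma touch_mono: "touch S T \<Longrightarrow> S \<subseteq> S' \<Longrightarrow> T \<subseteq> T' \<Longrightarrow> touch S' T'"
  unfolding touch_def by blast

lemma touch_empty [simp]: "\<not> touch {} T" "\<not> touch S {}"
  unfolding touch_def by auto

lemma touch_Un [simp]:
  "touch (S \<union> S') T \<longleftrightarrow> touch S T \<or> touch S' T"
  "touch S (T \<union> T') \<longleftrightarrow> touch S T \<or> touch S T'"
  unfolding touch_def by blast+

lemma touch_insert:
  "touch (insert x S) T \<longleftrightarrow> touch {x} T \<or> touch S T"
  "touch S (insert x T) \<longleftrightarrow> touch S {x} \<or> touch S T"
  unfolding touch_def by blast+

lemma conn_nonempty: "conn S \<Longrightarrow> S \<noteq> {}"
  unfolding conn_def by blast

lemma conn_touch:
  assumes "conn S" "P \<union> Q = S" "P \<inter> Q = {}" "P \<noteq> {}" "Q \<noteq> {}"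
  shows "touch P Q"
proof -
  have "P \<subset> S" and "S - P = Q"
    using assms by blast+
  then show ?thesis
    using assms unfolding conn_def by blast
qed

lemma conn_singleton: "conn {x}"
  unfolding conn_def by auto

text \<open>A set \<open>P\<close> that splits neither \<open>S\<close> nor \<open>T\<close>
  contains or misses each of them entirely; as they share a point, it contains both or misses
  both.\<close>

lemma conn_Un_overlap:
  assumes "conn S" "conn T" "S \<inter> T \<noteq> {}"
  shows "conn (S \<union> T)"
  unfolding conn_def
proof (intro conjI allI impI)
  show "S \<union> T \<noteq> {}"
    using assms by blast
next
  fix P assume P: "P \<subset> S \<union> T \<and> P \<noteq> {}"
  show "touch P (S \<union> T - P)"
  proof (cases "(P \<inter> S \<noteq> {} \<and> \<not> S \<subseteq> P) \<or> (P \<inter> T \<noteq> {} \<and> \<not> T \<subseteq> P)")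
    case True
    then have "touch (P \<inter> S) (S - P) \<or> touch (P \<inter> T) (T - P)"
      using conn_touch[OF assms(1), of "P \<inter> S" "S - P"] conn_touch[OF assms(2), of "P \<inter> T" "T - P"]
      by blast
    then show ?thesis
      by (elim disjE) (erule touch_mono; blast)+
  next
    case False
    then show ?thesis
      using P assms(3) by blast
  qed
qed

lemma conn_Un:
  assumes "conn S" "conn T" "touch S T"
  shows "conn (S \<union> T)"
proof -
  obtain x y where xy: "x \<in> S" "y \<in> T" "(x, y) \<in> E"
    using assms(3) unfolding touch_def by blast
  have "(y, x) \<in> E"
    using xy sym_E unfolding sym_def by blast
  have "conn {x, y}"
    unfolding conn_def
  proof (intro conjI allI impI)
    fix P assume P: "P \<subset> {x, y} \<and> P \<noteq> {}"
    then have "P = {x} \<or> P = {y}" "x \<noteq> y"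
      by blast+
    then show "touch P ({x, y} - P)"
      using xy(3) \<open>(y, x) \<in> E\<close> unfolding touch_def by blast
  qed simp
  then have "conn (S \<union> {x, y})"
    by (rule conn_Un_overlap[OF assms(1)]) (use xy in auto)
  then have "conn ((S \<union> {x, y}) \<union> T)"
    by (rule conn_Un_overlap[OF _ assms(2)]) (use xy in auto)
  moreover have "(S \<union> {x, y}) \<union> T = S \<union> T"
    using xy by auto
  ultimately show ?thesis
    by simp
qed

lemma conn_insert: "conn S \<Longrightarrow> touch S {x} \<Longrightarrow> conn (insert x S)"
  using conn_Un[of S "{x}"] conn_singleton by simp

lemma conn_closed_exit:
  assumes "conn S" "Z \<inter> S \<noteq> {}" "\<not> S \<subseteq> Z"
  shows "touch (Z \<inter> S) (S - Z)"
  by (rule conn_touch[OF assms(1)]) (use assms in auto)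

text \<open>Vertices left over by a path argument are never discarded: as \<open>Z\<close> is
  connected, some leftover vertex touches \<open>P\<close> or \<open>Q\<close> and can join
  it.\<close>

lemma conn_absorb:
  assumes "finite Z" "conn Z" "conn P" "conn Q" "P \<inter> Q = {}" "P \<union> Q \<subseteq> Z"
  shows "\<exists>P' Q'. P \<subseteq> P' \<and> Q \<subseteq> Q' \<and> conn P' \<and> conn Q' \<and> P' \<inter> Q' = {} \<and> P' \<union> Q' = Z"
  using assms(3-)
proof (induction "card (Z - (P \<union> Q))" arbitrary: P Q rule: less_induct)
  case less
  show ?case
  proof (cases "P \<union> Q = Z")
    case True
    then show ?thesis
      using less.prems by blast
  next
    case False
    then have "touch (P \<union> Q) (Z - (P \<union> Q))"
      using less.prems conn_nonempty[OF less.prems(1)]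
      by (intro conn_touch[OF assms(2)]) auto
    then obtain z where z: "z \<in> Z" "z \<notin> P" "z \<notin> Q" "touch P {z} \<or> touch Q {z}"
      unfolding touch_def by blast
    have less_card: "card (Z - insert z (P \<union> Q)) < card (Z - (P \<union> Q))"
      using z assms(1) by (intro psubset_card_mono) auto
    from z(4) show ?thesis
    proof
      assume "touch P {z}"
      then have "conn (insert z P)"
        using less.prems by (intro conn_insert) auto
      with less.hyps[of "insert z P" Q] less.prems less_card z show ?thesis
        by auto
    next
      assume "touch Q {z}"
      then have "conn (insert z Q)"
        using less.prems by (intro conn_insert) auto
      with less.hyps[of P "insert z Q"] less.prems less_card z show ?thesis
        by auto
    qed
  qed
qed

section \<open>Two disjoint paths: a cut form of Menger's theorem\<close>

definition path_through :: "'a set \<Rightarrow> 'a set \<Rightarrow> 'a set \<Rightarrow> bool" where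
  "path_through W P T \<longleftrightarrow> P = {} \<and> touch W T \<or> conn P \<and> touch W P \<and> touch P T"

text \<open>No closed set \<open>Z\<close> of vertices separates \<open>W\<close> from \<open>T\<close> inside \<open>W \<union> D\<close>; this cut form is what
  \<open>2\<close>-connectedness delivers directly and it is stable under moving a vertex of \<open>D\<close> into \<open>W\<close>.\<close>

definition unseparated :: "'a set \<Rightarrow> 'a set \<Rightarrow> 'a set \<Rightarrow> bool" where
  "unseparated W D T \<longleftrightarrow> (\<forall>Z. W \<subseteq> Z \<and> Z \<subseteq> W \<union> D \<longrightarrow> touch Z (T \<union> (D - Z)))"

lemma unseparated_insert:
  "unseparated W D T \<Longrightarrow> w \<in> D \<Longrightarrow> unseparated (insert w W) (D - {w}) T"
  unfolding unseparated_def
proof (intro allI impI)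
  fix Z assume *: "\<forall>Z. W \<subseteq> Z \<and> Z \<subseteq> W \<union> D \<longrightarrow> touch Z (T \<union> (D - Z))" and "w \<in> D"
    and Z: "insert w W \<subseteq> Z \<and> Z \<subseteq> insert w W \<union> (D - {w})"
  then have "touch Z (T \<union> (D - Z))"
    by blast
  moreover have "D - Z = D - {w} - Z"
    using Z by blast
  ultimately show "touch Z (T \<union> (D - {w} - Z))"
    by simp
qed

lemma path_through_insert_source:
  "path_through (insert w W) P T \<Longrightarrow> path_through W P T \<or> path_through {w} P T"
  unfolding path_through_def touch_insert(1)[of w W] by blast

lemma path_through_Un_target:
  "path_through W P (T \<union> T') \<Longrightarrow> path_through W P T \<or> path_through W P T'"
  unfolding path_through_def by auto

lemma path_through_prepend:
  assumes "path_through {w} P T" "touch W {w}"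
  shows "path_through W (insert w P) T"
proof -
  have "conn (insert w P)"
    using assms(1) conn_insert[of P w] unfolding path_through_def
    by (auto simp: conn_singleton touch_commute)
  then show ?thesis
    using assms unfolding path_through_def by (auto simp: touch_insert(1)[of w P] touch_insert(2)[of _ w P])
qed

text \<open>A path that runs into \<open>P\<close> instead of \<open>T\<close> is completed along
  \<open>P\<close>. Interiors are mere connected sets, so the two are merged and no walk has to be
  cut.\<close>

lemma path_through_append:
  assumes "path_through W Q (T \<union> P)" "path_through S P T"
  shows "\<exists>Q' \<subseteq> Q \<union> P. path_through W Q' T"
proof (cases "path_through W Q T")
  case False
  then have Q: "path_through W Q P"
    using assms(1) path_through_Un_target by blast
  then have "P \<noteq> {}"
    unfolding path_through_def by auto
  then have P: "conn P" "touch P T"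
    using assms(2) unfolding path_through_def by auto
  from Q have "path_through W (Q \<union> P) T"
    unfolding path_through_def using P conn_Un[of Q P] by auto
  then show ?thesis
    by blast
qed blast

lemma unseparated_path:
  assumes "finite D" "unseparated W D T"
  shows "\<exists>P \<subseteq> D. path_through W P T"
  using assms
proof (induction "card D" arbitrary: W D rule: less_induct)
  case less
  have "touch W (T \<union> (D - W))"
    using less.prems(2) unfolding unseparated_def by blast
  then consider "touch W T" | w where "w \<in> D" "touch W {w}"
    unfolding touch_def by blast
  then show ?case
  proof cases
    case 1
    then show ?thesis
      unfolding path_through_def by blast
  next
    case 2
    have "card (D - {w}) < card D"
      using 2 less.prems(1) by (metis card_Diff1_less)
    with less.hyps[of "D - {w}" "insert w W"] less.prems unseparated_insert 2
    obtain P where "P \<subseteq> D - {w}" "path_through (insert w W) P T"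
      by auto
    then show ?thesis
      using path_through_insert_source path_through_prepend 2
      by (metis Diff_subset insert_subset subset_trans)
  qed
qed

text \<open>Menger's theorem for two paths, with \<open>W\<close>, \<open>S\<close> and \<open>T\<close> regarded as contracted: grow \<open>W\<close> by one
  neighbour \<open>w\<close>; if both paths obtained by induction start at \<open>w\<close>, a path avoiding \<open>w\<close> takes over one of them.\<close>

lemma two_disjoint_paths:
  assumes "finite D" "unseparated W D S" "unseparated W D T"
    and "\<And>t. t \<in> D \<Longrightarrow> unseparated W (D - {t}) (S \<union> T)"
  shows "\<exists>P Q. P \<subseteq> D \<and> Q \<subseteq> D \<and> P \<inter> Q = {} \<and> path_through W P S \<and> path_through W Q T"
  using assms
proof (induction "card D" arbitrary: W D rule: less_induct)
  case less
  have touch: "touch W (S \<union> (D - W))" "touch W (T \<union> (D - W))"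
    using less.prems(2,3) unfolding unseparated_def by blast+
  consider "touch W S" | "touch W T" | w where "w \<in> D" "w \<notin> W" "touch W {w}"
    using touch unfolding touch_def by blast
  then show ?case
  proof cases
    case 1
    then show ?thesis
      using unseparated_path[OF less.prems(1,3)] unfolding path_through_def by blast
  next
    case 2
    then show ?thesis
      using unseparated_path[OF less.prems(1,2)] unfolding path_through_def by blast
  next
    case 3
    have "unseparated (insert w W) (D - {w} - {t}) (S \<union> T)" if "t \<in> D - {w}" for t
    proof -
      have "D - {w} - {t} = D - {t} - {w}"
        by blast
      then show ?thesis
        using unseparated_insert[of W "D - {t}" "S \<union> T" w] less.prems(4)[of t] that 3(1)
        by auto
    qed
    moreover have "card (D - {w}) < card D"
      using 3 less.prems(1) by (metis card_Diff1_less)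
    ultimately obtain P Q where PQ: "P \<subseteq> D - {w}" "Q \<subseteq> D - {w}" "P \<inter> Q = {}"
        "path_through (insert w W) P S" "path_through (insert w W) Q T"
      using less.hyps[of "D - {w}" "insert w W"] less.prems unseparated_insert[OF _ 3(1)]
      by (metis finite_Diff)
    consider "path_through W P S" "path_through W Q T" | "path_through W P S" "path_through {w} Q T"
      | "path_through {w} P S" "path_through W Q T" | "path_through {w} P S" "path_through {w} Q T"
      using PQ(4,5) path_through_insert_source by blast
    then show ?thesis
    proof cases
      case 1
      then show ?thesis
        using PQ by blast
    next
      case 2
      then have "path_through W (insert w Q) T"
        using path_through_prepend 3 by blast
      then show ?thesis
        using PQ(1-3) 2(1) 3(1) by - (rule exI[of _ P], rule exI[of _ "insert w Q"], intro conjI; blast)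
    next
      case third: 3
      then have "path_through W (insert w P) S"
        using path_through_prepend 3 by blast
      then show ?thesis
        using PQ(1-3) third(2) 3(1) by - (rule exI[of _ "insert w P"], rule exI[of _ Q], intro conjI; blast)
    next
      case 4
      \<comment> \<open>Moving \<open>P\<close> and \<open>Q\<close> into the targets keeps the new
        path \<open>R\<close> off both. If \<open>R\<close> ends on \<open>P\<close> it continues
        along \<open>P\<close>, and the path through \<open>Q\<close> is the one led over
        \<open>w\<close>; symmetrically for \<open>Q\<close>.\<close>
      have "unseparated W (D - {w} - P - Q) ((S \<union> P) \<union> (T \<union> Q))"
        unfolding unseparated_def
      proof (intro allI impI)
        fix Z assume Z: "W \<subseteq> Z \<and> Z \<subseteq> W \<union> (D - {w} - P - Q)"
        then have "touch Z ((S \<union> T) \<union> (D - {w} - Z))"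
          using less.prems(4)[OF 3(1)] unfolding unseparated_def by blast
        then show "touch Z ((S \<union> P) \<union> (T \<union> Q) \<union> (D - {w} - P - Q - Z))"
          by (rule touch_mono) auto
      qed
      then obtain R where R: "R \<subseteq> D - {w} - P - Q" "path_through W R ((S \<union> P) \<union> (T \<union> Q))"
        using unseparated_path less.prems(1) by (meson finite_Diff)
      from path_through_Un_target[OF R(2)] show ?thesis
      proof
        assume "path_through W R (S \<union> P)"
        then obtain R' where "R' \<subseteq> R \<union> P" "path_through W R' S"
          using path_through_append[OF _ 4(1)] by metis
        then show ?thesis
          using R(1) PQ(1-3) 3(1) path_through_prepend[OF 4(2) 3(3)]
          by - (rule exI[of _ R'], rule exI[of _ "insert w Q"], intro conjI; blast)
      next
        assume "path_through W R (T \<union> Q)"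
        then obtain R' where "R' \<subseteq> R \<union> Q" "path_through W R' T"
          using path_through_append[OF _ 4(2)] by metis
        then show ?thesis
          using R(1) PQ(1-3) 3(1) path_through_prepend[OF 4(1) 3(3)]
          by - (rule exI[of _ "insert w P"], rule exI[of _ R'], intro conjI; blast)
      qed
    qed
  qed
qed

section \<open>Constructing connected sets and connected partitions\<close>

lemma conn_if_common_point:
  assumes "x\<^sub>0 \<in> Z" "\<And>x. x \<in> Z \<Longrightarrow> \<exists>C. conn C \<and> x\<^sub>0 \<in> C \<and> x \<in> C \<and> C \<subseteq> Z"
  shows "conn Z"
  unfolding conn_def
proof (intro conjI allI impI)
  show "Z \<noteq> {}"
    using assms(1) by blast
next
  fix P assume P: "P \<subset> Z \<and> P \<noteq> {}"
  obtain y where y: "y \<in> Z" "x\<^sub>0 \<in> P \<longleftrightarrow> y \<notin> P"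
    using P by blast
  then obtain C where C: "conn C" "x\<^sub>0 \<in> C" "y \<in> C" "C \<subseteq> Z"
    using assms(2) by blast
  then have "touch (P \<inter> C) (C - P)"
    by (intro conn_closed_exit) (use y in auto)
  then show "touch P (Z - P)"
    by (rule touch_mono) (use C in auto)
qed

text \<open>Leads the root of a tree back to \<open>r\<close> when it is only known to touch
  \<open>r \<union> P\<close>. Since \<open>r\<close> must stay outside the tree, only a path inside
  \<open>P\<close> is added; it exists because \<open>r \<union> P\<close> is connected.\<close>

lemma conn_extend:
  assumes "finite P" "conn (r \<union> P)" "r \<noteq> {}" "conn S" "touch S (r \<union> P)" "r \<inter> (S \<union> P) = {}"
  shows "\<exists>P' \<subseteq> P. conn (S \<union> P') \<and> touch (S \<union> P') r"
proof -
  have "unseparated S P r"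
    unfolding unseparated_def
  proof (intro allI impI)
    fix Z assume Z: "S \<subseteq> Z \<and> Z \<subseteq> S \<union> P"
    show "touch Z (r \<union> (P - Z))"
    proof (cases "Z \<inter> (r \<union> P) = {}")
      case True
      then have "P - Z = P"
        by blast
      then show ?thesis
        using assms(5) Z touch_mono by (metis subset_refl)
    next
      case False
      have "\<not> r \<union> P \<subseteq> Z"
        using Z assms(3,6) by blast
      then show ?thesis
        by (rule touch_mono[OF conn_closed_exit[OF assms(2) False]]) auto
    qed
  qed
  then obtain P' where "P' \<subseteq> P" "path_through S P' r"
    using unseparated_path assms(1) by blast
  then show ?thesis
    unfolding path_through_def using assms(4) conn_Un[of S P'] by (intro exI[of _ P']) auto
qed

text \<open>The set of vertices reachable from \<open>u\<close> has no exit; conversely, a walk from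
  \<open>P\<close> to its complement contains an arc leaving \<open>P\<close>.\<close>

lemma conn_iff_rtrancl_on:
  "conn S \<longleftrightarrow> S \<noteq> {} \<and> (\<forall>u \<in> S. \<forall>v \<in> S. (u, v) \<in> rtrancl_on S (E \<inter> S \<times> S))"
proof
  assume S: "conn S"
  have "(u, v) \<in> rtrancl_on S (E \<inter> S \<times> S)" if uv: "u \<in> S" "v \<in> S" for u v
  proof (rule ccontr)
    define Z where "Z = {w. (u, w) \<in> rtrancl_on S (E \<inter> S \<times> S)}"
    assume "\<not> ?thesis"
    then have "touch (Z \<inter> S) (S - Z)"
      by (intro conn_closed_exit[OF S]) (use uv Z_def in auto)
    then show False
      unfolding touch_def Z_def by (auto intro: rtrancl_on_into_rtrancl_on)
  qed
  then show "S \<noteq> {} \<and> (\<forall>u \<in> S. \<forall>v \<in> S. (u, v) \<in> rtrancl_on S (E \<inter> S \<times> S))"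
    using conn_nonempty[OF S] by blast
next
  assume S: "S \<noteq> {} \<and> (\<forall>u \<in> S. \<forall>v \<in> S. (u, v) \<in> rtrancl_on S (E \<inter> S \<times> S))"
  show "conn S"
    unfolding conn_def
  proof (intro conjI allI impI)
    fix P assume P: "P \<subset> S \<and> P \<noteq> {}"
    then obtain u v where "u \<in> P" "u \<in> S" "v \<in> S" "v \<notin> P"
      by blast
    moreover from this have "(u, v) \<in> rtrancl_on S (E \<inter> S \<times> S)"
      using S by blast
    then have "u \<in> P \<Longrightarrow> v \<notin> P \<Longrightarrow> touch P (S - P)"
    proof (induction rule: rtrancl_on.induct)
      case (rtrancl_on_into_rtrancl_on w x)
      then show ?case
        unfolding touch_def by (cases "w \<in> P") auto
    qed auto
    ultimately show "touch P (S - P)"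
      by blast
  qed (use S in blast)
qed

text \<open>The greedy growth of \<open>conn_absorb\<close> with arbitrarily many parts. Covering
  all of \<open>V\<close> is what later makes complements of subtrees unions of branch sets, hence
  connected.\<close>

lemma extend_to_partition:
  assumes "finite V" "conn V" "N \<noteq> {}"
    and "\<And>n. n \<in> N \<Longrightarrow> conn (B n) \<and> B n \<subseteq> V" "disjoint_family_on B N"
  shows "\<exists>B'. (\<forall>n \<in> N. B n \<subseteq> B' n \<and> conn (B' n)) \<and> disjoint_family_on B' N \<and> (\<Union>n \<in> N. B' n) = V"
  using assms(4,5)
proof (induction "card (V - (\<Union>n \<in> N. B n))" arbitrary: B rule: less_induct)
  case less
  show ?case
  proof (cases "(\<Union>n \<in> N. B n) = V")
    case True
    then show ?thesis
      using less.prems by blast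
  next
    case False
    have sub: "(\<Union>n \<in> N. B n) \<subseteq> V"
      using less.prems(1) by blast
    have "(\<Union>n \<in> N. B n) \<noteq> {}"
      using assms(3) less.prems(1) conn_nonempty by blast
    with False sub have "touch (\<Union>n \<in> N. B n) (V - (\<Union>n \<in> N. B n))"
      by (intro conn_touch[OF assms(2)]) blast+
    then obtain m z where z: "m \<in> N" "z \<in> V" "z \<notin> (\<Union>n \<in> N. B n)" "touch (B m) {z}"
      unfolding touch_def by blast
    define B1 where "B1 = B(m := insert z (B m))"
    have "conn (insert z (B m))"
      using less.prems(1)[OF z(1)] z(4) by (intro conn_insert) auto
    then have B1: "conn (B1 n) \<and> B1 n \<subseteq> V" if "n \<in> N" for n
      using less.prems(1)[OF that] z(2) unfolding B1_def by auto
    have B_B1: "B n \<subseteq> B1 n" for n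
      unfolding B1_def by auto
    have "disjoint_family_on B1 N"
      using less.prems(2) z(3) unfolding disjoint_family_on_def B1_def by auto
    moreover have "card (V - (\<Union>n \<in> N. B1 n)) < card (V - (\<Union>n \<in> N. B n))"
    proof (rule psubset_card_mono)
      have "z \<in> (\<Union>n \<in> N. B1 n)" "(\<Union>n \<in> N. B n) \<subseteq> (\<Union>n \<in> N. B1 n)"
        using z(1) B_B1 unfolding B1_def by auto
      then show "V - (\<Union>n \<in> N. B1 n) \<subset> V - (\<Union>n \<in> N. B n)"
        using z(2,3) by blast
    qed (use assms(1) in simp)
    ultimately obtain B' where B': "\<forall>n \<in> N. B1 n \<subseteq> B' n \<and> conn (B' n)" "disjoint_family_on B' N" "(\<Union>n \<in> N. B' n) = V"
      using less.hyps[of B1] B1 by blast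
    have "\<forall>n \<in> N. B n \<subseteq> B' n \<and> conn (B' n)"
      using B'(1) B_B1 by blast
    then show ?thesis
      using B'(2,3) by blast
  qed
qed

end

section \<open>Splitting two-connected graphs\<close>

locale biconnected = symmetric_relation E for E :: "('a \<times> 'a) set" +
  fixes V :: "'a set"
  assumes finite_V: "finite V"
    and E_subset: "E \<subseteq> V \<times> V"
    and conn_delete: "conn (V - {t})"
begin

definition enclosed :: "'a set \<Rightarrow> 'a set \<Rightarrow> bool" where
  "enclosed Z S \<longleftrightarrow> (\<forall>x \<in> Z. \<forall>y. (x, y) \<in> E \<longrightarrow> y \<in> Z \<union> S)"

lemma enclosed_not_touch: "enclosed Z S \<Longrightarrow> T \<inter> (Z \<union> S) = {} \<Longrightarrow> \<not> touch Z T"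
  unfolding enclosed_def touch_def by blast

text \<open>Every use of \<open>conn_delete\<close> passes through here: after deletion of
  \<open>t\<close>, the set \<open>Z\<close> still has a neighbour outside itself, and enclosure
  places it in \<open>S\<close>.\<close>

lemma exit_enclosed:
  assumes "enclosed Z S" "Z \<noteq> {}" "Z \<subseteq> V" "t \<notin> Z" "\<not> V \<subseteq> insert t Z"
  shows "touch Z (S - {t} - Z)"
proof -
  have "touch Z (V - {t} - Z)"
    by (rule conn_touch[OF conn_delete[of t]]) (use assms in auto)
  then show ?thesis
    using assms(1) unfolding enclosed_def touch_def by blast
qed

lemma touch_enclosed:
  assumes "enclosed W R" "W \<subseteq> V" "W \<noteq> {}" "W \<inter> R = {}" "touch R T" "T \<inter> (W \<union> R) = {}" "T \<subseteq> V"
  shows "touch W R"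
proof -
  obtain t where t: "t \<in> T"
    using assms(5) unfolding touch_def by blast
  obtain x where x: "x \<in> R"
    using assms(5) unfolding touch_def by blast
  show ?thesis
  proof (cases "V \<subseteq> insert x W")
    case True
    then show ?thesis
      using t x assms by blast
  next
    case False
    then have "touch W (R - {x} - W)"
      using assms x by (intro exit_enclosed) auto
    then show ?thesis
      by (rule touch_mono) auto
  qed
qed

text \<open>If no two disjoint paths lead from \<open>W\<close> to \<open>A\<close> and to \<open>M\<close> through the ring \<open>R\<close>, a single vertex \<open>t\<close>
  separates \<open>W\<close> from \<open>A \<union> M\<close>; then \<open>2\<close>-connectedness yields disjoint paths from \<open>W\<close> to \<open>t\<close> and to \<open>C\<close>.\<close>

lemma split_ring:
  assumes W: "W \<noteq> {}" "enclosed W R"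
    and R: "conn R" "enclosed R (W \<union> A \<union> M \<union> C)"
    and sub: "W \<union> R \<union> A \<union> M \<union> C \<subseteq> V"
    and disj: "W \<inter> R = {}" "(W \<union> R) \<inter> (A \<union> M \<union> C) = {}"
    and touch: "touch R A" "touch R M"
  shows "\<exists>P Q. conn P \<and> conn Q \<and> P \<inter> Q = {} \<and> P \<union> Q = R \<and> touch W P \<and> touch W Q \<and> touch P A \<and>
    (touch Q M \<or> touch P M \<and> touch Q C \<and> \<not> touch Q A \<and> \<not> touch Q M)"
proof -
  \<comment> \<open>A vertex beyond \<open>W \<union> R\<close> guarantees below that deleting one
    ring vertex leaves something for \<open>W\<close> to be connected to.\<close>
  obtain a where a: "a \<in> A" "a \<notin> W" "a \<notin> R" "a \<in> V"
    using touch(1) sub disj unfolding touch_def by blast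
  have fin: "finite R"
    using sub finite_V by (meson finite_subset le_sup_iff)
  have W_out: "\<not> touch W A" "\<not> touch W M" "\<not> touch W C"
    using disj by (auto intro!: enclosed_not_touch[OF W(2)])
  have WR: "touch W R"
    by (rule touch_enclosed[OF W(2) _ W(1) disj(1) touch(1)]) (use sub disj in auto)
  have reach: "unseparated W R T" if T: "touch R T" for T
    unfolding unseparated_def
  proof (intro allI impI)
    fix Z assume Z: "W \<subseteq> Z \<and> Z \<subseteq> W \<union> R"
    consider "Z \<inter> R = {}" | "R \<subseteq> Z" | "Z \<inter> R \<noteq> {}" "\<not> R \<subseteq> Z"
      by blast
    then show "touch Z (T \<union> (R - Z))"
    proof cases
      case 1
      then show ?thesis
        using WR Z by (intro touch_mono[OF WR]) auto
    next
      case 2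
      then show ?thesis
        by (intro touch_mono[OF T]) auto
    next
      case 3
      show ?thesis
        by (rule touch_mono[OF conn_closed_exit[OF R(1) 3]]) auto
    qed
  qed
  show ?thesis
  proof (cases "\<forall>t \<in> R. unseparated W (R - {t}) (A \<union> M)")
    case True
    then obtain P Q where "P \<subseteq> R" "Q \<subseteq> R" "P \<inter> Q = {}" "path_through W P A" "path_through W Q M"
      using two_disjoint_paths[OF fin reach[OF touch(1)] reach[OF touch(2)]] by blast
    then have PQ: "conn P" "conn Q" "P \<inter> Q = {}" "P \<union> Q \<subseteq> R" "touch W P" "touch P A" "touch W Q" "touch Q M"
      using W_out unfolding path_through_def by auto
    obtain P' Q' where "P \<subseteq> P'" "Q \<subseteq> Q'" "conn P'" "conn Q'" "P' \<inter> Q' = {}" "P' \<union> Q' = R"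
      using conn_absorb[OF fin R(1) PQ(1-4)] by blast
    then show ?thesis
      using PQ touch_mono by - (rule exI[of _ P'], rule exI[of _ Q'], intro conjI; (meson subset_refl))
  next
    case False
    then obtain t Z where t: "t \<in> R" and Z: "W \<subseteq> Z" "Z \<subseteq> W \<union> (R - {t})"
        "\<not> touch Z (A \<union> M \<union> (R - {t} - Z))"
      unfolding unseparated_def by blast
    \<comment> \<open>\<open>D\<close> is the part of the ring that \<open>t\<close> cuts off
      together with \<open>W\<close>; \<open>F\<close> is the rest and contains
      \<open>t\<close>.\<close>
    define D where "D = Z - W"
    define F where "F = R - D"
    have D: "D \<subseteq> R" "t \<notin> D" "t \<in> F" "Z = W \<union> D" "D \<inter> W = {}" "t \<notin> Z"
      using Z t disj unfolding D_def F_def by auto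
    have sep: "\<not> touch D A" "\<not> touch D M" "\<not> touch Z (R - {t} - Z)"
      using Z(3) D(4) by auto
    have Z_enc: "enclosed Z (insert t C)"
      using W(2) R(2) Z(3) D unfolding enclosed_def touch_def by blast
    \<comment> \<open>All edges between \<open>D\<close> and \<open>F\<close> end in
      \<open>t\<close>, so taking \<open>D\<close> away from the connected ring cannot disconnect
      \<open>F\<close>.\<close>
    have "conn F"
      unfolding conn_def
    proof (intro conjI allI impI)
      show "F \<noteq> {}"
        using D by auto
    next
      fix S assume S: "S \<subset> F \<and> S \<noteq> {}"
      have *: "touch S' (F - S')" if "S' \<subset> F" "S' \<noteq> {}" "t \<notin> S'" for S'
      proof -
        have "touch S' (R - S')"
          by (rule conn_touch[OF R(1)]) (use that F_def in auto)
        moreover have "\<not> touch D S'"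
        proof
          assume "touch D S'"
          then have "touch Z (R - {t} - Z)"
            by (rule touch_mono) (use that D disj F_def in auto)
          then show False
            using sep by simp
        qed
        moreover have "R - S' = D \<union> (F - S')"
          using that D F_def by auto
        ultimately show ?thesis
          by (simp add: touch_commute)
      qed
      show "touch S (F - S)"
      proof (cases "t \<in> S")
        case True
        then have "touch (F - S) (F - (F - S))"
          by (intro *) (use S D in auto)
        moreover have "F - (F - S) = S"
          using S by auto
        ultimately show ?thesis
          by (simp add: touch_commute)
      qed (use * S in auto)
    qed
    \<comment> \<open>By the choice of \<open>Z\<close>, a set between \<open>W\<close> and
      \<open>Z\<close> can be left only towards \<open>t\<close>, \<open>C\<close> or
      \<open>D\<close>. By 2-connectedness an exit remains when \<open>u\<close> is deleted; this
      yields the cut conditions for disjoint paths from \<open>W\<close> to \<open>t\<close> and to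
      \<open>C\<close>.\<close>
    have out: "touch Z' ((insert t C - {u}) \<union> (D - {u} - Z'))"
      if Z': "W \<subseteq> Z'" "Z' \<subseteq> Z" "u \<notin> Z'" "u \<in> R" for Z' u
    proof -
      have "enclosed Z' (insert t C \<union> D)"
        using Z' Z_enc D(4) unfolding enclosed_def by blast
      then have "touch Z' (insert t C \<union> D - {u} - Z')"
        by (rule exit_enclosed) (use Z' W(1) sub a D in blast)+
      then show ?thesis
        by (rule touch_mono) auto
    qed
    have "unseparated W D {t}"
      unfolding unseparated_def
    proof (intro allI impI)
      fix Z' assume Z': "W \<subseteq> Z' \<and> Z' \<subseteq> W \<union> D"
      have sep': "\<not> touch Z' (R - {t} - Z)"
        using sep(3) touch_mono Z' D(4) by (metis subset_refl)
      have "touch Z' (R - Z')"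
      proof (cases "Z' \<inter> R = {}")
        case True
        then show ?thesis
          using Z' by (intro touch_mono[OF WR]) auto
      next
        case False
        then show ?thesis
          by (rule touch_mono[OF conn_closed_exit[OF R(1)]]) (use Z' t D disj in auto)
      qed
      then show "touch Z' ({t} \<union> (D - Z'))"
        using sep' D t Z' disj unfolding touch_def by blast
    qed
    moreover have "unseparated W D C"
      unfolding unseparated_def
    proof (intro allI impI)
      fix Z' assume "W \<subseteq> Z' \<and> Z' \<subseteq> W \<union> D"
      then have "touch Z' ((insert t C - {t}) \<union> (D - {t} - Z'))"
        by (intro out) (use D t in auto)
      then show "touch Z' (C \<union> (D - Z'))"
        by (rule touch_mono) auto
    qed
    moreover have "unseparated W (D - {u}) ({t} \<union> C)" if "u \<in> D" for u
      unfolding unseparated_def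
    proof (intro allI impI)
      fix Z' assume "W \<subseteq> Z' \<and> Z' \<subseteq> W \<union> (D - {u})"
      then have "touch Z' ((insert t C - {u}) \<union> (D - {u} - Z'))"
        by (intro out) (use D that in auto)
      then show "touch Z' ({t} \<union> C \<union> (D - {u} - Z'))"
        by (rule touch_mono) auto
    qed
    moreover have "finite D"
      using fin D(1) finite_subset by blast
    ultimately obtain P Q where PQ: "P \<subseteq> D" "Q \<subseteq> D" "P \<inter> Q = {}" "path_through W P {t}" "path_through W Q C"
      using two_disjoint_paths[of D W "{t}" C] by blast
    have Q: "conn Q" "touch W Q" "touch Q C"
      using PQ(5) W_out unfolding path_through_def by auto
    have "P = {} \<and> touch W F \<or> conn P \<and> touch W P \<and> touch F P"
      using PQ(4) D(3) unfolding path_through_def touch_commute[of F] by (auto simp: touch_def)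
    then have P: "conn (F \<union> P)" "touch W (F \<union> P)"
      using \<open>conn F\<close> conn_Un[of F P] by auto
    have "(F \<union> P) \<inter> Q = {}" "F \<union> P \<union> Q \<subseteq> R"
      using PQ D F_def by auto
    from conn_absorb[OF fin R(1) P(1) Q(1) this]
    obtain P' Q' where PQ': "F \<union> P \<subseteq> P'" "Q \<subseteq> Q'" "conn P'" "conn Q'" "P' \<inter> Q' = {}" "P' \<union> Q' = R"
      by blast
    \<comment> \<open>Being disjoint from \<open>F\<close>, the half \<open>Q'\<close> inherits from
      \<open>D\<close> that it touches neither \<open>A\<close> nor \<open>M\<close>; so both
      contacts of the ring belong to \<open>F\<close>, hence to \<open>P'\<close>.\<close>
    have "Q' \<subseteq> D" "R = F \<union> D"
      using PQ' F_def D by auto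
    then have "touch F A" "touch F M" "\<not> touch Q' A" "\<not> touch Q' M"
      using touch sep touch_mono by auto
    then show ?thesis
      using PQ' P(2) Q touch_mono
      by - (rule exI[of _ P'], rule exI[of _ Q'], intro conjI; (meson le_sup_iff subset_refl))
  qed
qed

section \<open>States, steps and chains\<close>

definition state :: "'a set \<Rightarrow> 'a set \<Rightarrow> 'a set \<Rightarrow> bool" where
  "state r s U \<longleftrightarrow> conn r \<and> conn s \<and> r \<inter> s = {} \<and> (r \<union> s) \<inter> U = {} \<and> r \<union> s \<subseteq> V \<and>
     touch r s \<and> touch U r \<and> touch U s \<and> enclosed U (r \<union> s)"

text \<open>A fan step attaches \<open>Z\<close> and \<open>Z'\<close> in parallel between a new tree node \<open>X\<close>, hanging from \<open>r\<close>, and the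
  extended apex \<open>s \<union> Y\<close>. A nabla step places them in series between \<open>r\<close> and \<open>s\<close>, with \<open>M\<close> in the middle.\<close>

definition fan_step :: "'a set \<Rightarrow> 'a set \<Rightarrow> 'a set \<Rightarrow> 'a set \<Rightarrow> 'a set \<Rightarrow> bool" where
  "fan_step r s U Z Z' \<longleftrightarrow> (\<exists>X Y. X \<union> Y \<subseteq> U \<and> touch r X \<and> state X (s \<union> Y) Z \<and> state X (s \<union> Y) Z')"

definition nabla_step :: "'a set \<Rightarrow> 'a set \<Rightarrow> 'a set \<Rightarrow> 'a set \<Rightarrow> 'a set \<Rightarrow> bool" where
  "nabla_step r s U Z Z' \<longleftrightarrow> (\<exists>A M C. A \<union> M \<union> C \<subseteq> U \<and> (r \<union> A) \<inter> (s \<union> C) = {} \<and>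
     A \<inter> Z' = {} \<and> C \<inter> Z = {} \<and> state (r \<union> A) M Z \<and> state M (s \<union> C) Z')"

text \<open>Weaker than a nabla step: \<open>A\<close> and \<open>M\<close>, or \<open>M\<close> and
  \<open>C\<close>, need not touch, and \<open>U\<close> and \<open>U'\<close> need not be enclosed
  by the sets next to them.\<close>

definition chain :: "'a set \<Rightarrow> 'a set \<Rightarrow> 'a set \<Rightarrow> 'a set \<Rightarrow> 'a set \<Rightarrow> bool" where
  "chain B r U U' s \<longleftrightarrow> (\<exists>A M C. conn A \<and> conn M \<and> conn C \<and>
     A \<inter> M = {} \<and> A \<inter> C = {} \<and> M \<inter> C = {} \<and> A \<union> M \<union> C = B \<and>
     touch r A \<and> touch A U \<and> touch U M \<and> touch M U' \<and> touch U' C \<and> touch C s)"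

lemma chain_rev: "chain B r U U' s \<Longrightarrow> chain B s U' U r"
proof -
  assume "chain B r U U' s"
  then obtain A M C where "conn A" "conn M" "conn C"
     "A \<inter> M = {}" "A \<inter> C = {}" "M \<inter> C = {}" "A \<union> M \<union> C = B"
     "touch r A" "touch A U" "touch U M" "touch M U'" "touch U' C" "touch C s"
    unfolding chain_def by blast
  then have "conn C \<and> conn M \<and> conn A \<and>
     C \<inter> M = {} \<and> C \<inter> A = {} \<and> M \<inter> A = {} \<and> C \<union> M \<union> A = B \<and>
     touch s C \<and> touch C U' \<and> touch U' M \<and> touch M U \<and> touch U A \<and> touch A r"
    by (auto simp: touch_commute)
  then show ?thesis
    unfolding chain_def by blast
qed

lemma stateI:
  assumes "conn X" "conn Y" "X \<inter> Y = {}" "(X \<union> Y) \<inter> W = {}" "X \<union> Y \<subseteq> V" "touch X Y"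
    and "touch W X" "touch W Y" "enclosed W R" "R \<subseteq> X \<union> Y"
  shows "state X Y W"
  using assms unfolding state_def enclosed_def by blast

text \<open>The set \<open>X\<close> is a ring around \<open>U2\<close>; split it with respect to
  \<open>r\<close> and \<open>U1\<close>, with \<open>Y \<union> s\<close> as escape. If
  \<open>Q\<close> touches \<open>U1\<close>, the order \<open>P\<close>, \<open>U2\<close>,
  \<open>Q\<close>, \<open>U1\<close>, \<open>Y\<close> is a chain. Otherwise \<open>P\<close>
  touches both subtrees and becomes the tree node, while \<open>Q\<close> joins the apex.\<close>

lemma fork_one_sided:
  assumes "conn r" "conn s" "conn X" "conn Y" "U1 \<noteq> {}" "U2 \<noteq> {}"
    and "enclosed U1 (X \<union> Y)" "enclosed U2 X" "enclosed X (U1 \<union> U2 \<union> Y \<union> r \<union> s)"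
    and disj: "X \<inter> Y = {}" "U1 \<inter> U2 = {}" "r \<inter> s = {}" "(X \<union> Y) \<inter> (U1 \<union> U2) = {}"
      "(r \<union> s) \<inter> (X \<union> Y \<union> U1 \<union> U2) = {}"
    and sub: "X \<union> Y \<union> U1 \<union> U2 \<union> r \<union> s \<subseteq> V"
    and touch: "touch X r" "touch Y s" "touch U1 X" "touch U1 Y"
  shows "chain (X \<union> Y) r U2 U1 s \<or> fan_step r s (X \<union> Y) U1 U2"
proof -
  have "enclosed X (U2 \<union> r \<union> U1 \<union> (Y \<union> s))"
    using assms(9) by (simp add: Un_ac)
  moreover have "U2 \<union> X \<union> r \<union> U1 \<union> (Y \<union> s) \<subseteq> V" "U2 \<inter> X = {}" "(U2 \<union> X) \<inter> (r \<union> U1 \<union> (Y \<union> s)) = {}"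
      "touch X U1"
    using sub disj touch(3) by (auto simp: touch_commute)
  ultimately obtain P Q where PQ: "conn P" "conn Q" "P \<inter> Q = {}" "P \<union> Q = X" "touch U2 P" "touch U2 Q" "touch P r"
    and alt: "touch Q U1 \<or> touch P U1 \<and> touch Q (Y \<union> s)"
    using split_ring[OF assms(6,8,3) _ _ _ _ touch(1)] by metis
  from alt show ?thesis
  proof
    assume "touch Q U1"
    then have "chain (X \<union> Y) r U2 U1 s"
      unfolding chain_def using PQ disj touch assms(4)
      by - (rule exI[of _ P], rule exI[of _ Q], rule exI[of _ Y], auto simp: touch_commute)
    then show ?thesis
      by blast
  next
    assume alt: "touch P U1 \<and> touch Q (Y \<union> s)"
    have sYQ: "conn (s \<union> (Y \<union> Q))"
    proof -
      have "conn ((s \<union> Y) \<union> Q)"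
        using assms PQ alt by (intro conn_Un) (auto simp: touch_commute)
      then show ?thesis
        by (simp add: Un_ac)
    qed
    have "touch P Q"
      using conn_touch[OF assms(3) PQ(4,3)] PQ(1,2) conn_nonempty by blast
    have "state P (s \<union> (Y \<union> Q)) U1"
      by (rule stateI[where R = "X \<union> Y"])
        (use PQ disj sub sYQ alt \<open>touch P Q\<close> assms(7) touch in \<open>auto simp: touch_commute\<close>)
    moreover have "state P (s \<union> (Y \<union> Q)) U2"
      by (rule stateI[where R = X])
        (use PQ disj sub sYQ alt \<open>touch P Q\<close> assms(8) touch in \<open>auto simp: touch_commute\<close>)
    ultimately have "fan_step r s (X \<union> Y) U1 U2"
      unfolding fan_step_def using PQ
      by - (rule exI[of _ P], rule exI[of _ "Y \<union> Q"], auto simp: touch_commute)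
    then show ?thesis
      by blast
  qed
qed

text \<open>Split \<open>B\<close> around \<open>U1\<close> with respect to \<open>r\<close> and
  \<open>s\<close>, with \<open>U2\<close> as escape. If the escape is taken, \<open>P\<close> holds
  all contacts with \<open>r\<close> and \<open>s\<close>, and everything else is regrouped into one
  set enclosed by \<open>P\<close>, around which \<open>P\<close> is split again.\<close>

lemma fork_separate:
  assumes "conn B" "U1 \<noteq> {}" "U2 \<noteq> {}"
    and enc: "enclosed U1 B" "enclosed U2 B" "enclosed B (U1 \<union> U2 \<union> r \<union> s)"
    and disj: "U1 \<inter> U2 = {}" "r \<inter> s = {}" "B \<inter> (U1 \<union> U2) = {}" "(r \<union> s) \<inter> (B \<union> U1 \<union> U2) = {}"
    and sub: "B \<union> U1 \<union> U2 \<union> r \<union> s \<subseteq> V"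
    and touch: "touch B r" "touch B s"
  shows "chain B r U1 U2 s \<or> chain B r U2 U1 s \<or>
    (\<exists>X Y. conn X \<and> conn Y \<and> X \<inter> Y = {} \<and> X \<union> Y = B \<and> touch X r \<and> touch Y s \<and> touch U1 X \<and> touch U1 Y)"
proof -
  have "enclosed B (U1 \<union> r \<union> s \<union> U2)"
    using enc(3) by (simp add: Un_ac)
  moreover have "U1 \<union> B \<union> r \<union> s \<union> U2 \<subseteq> V" "U1 \<inter> B = {}" "(U1 \<union> B) \<inter> (r \<union> s \<union> U2) = {}"
    using sub disj by auto
  ultimately obtain P Q where PQ: "conn P" "conn Q" "P \<inter> Q = {}" "P \<union> Q = B" "touch U1 P" "touch U1 Q" "touch P r"
    and alt: "touch Q s \<or> touch P s \<and> touch Q U2 \<and> \<not> touch Q r \<and> \<not> touch Q s"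
    using split_ring[OF assms(2) enc(1) assms(1) _ _ _ _ touch] by metis
  from alt show ?thesis
  proof
    assume "touch Q s"
    then show ?thesis
      using PQ by blast
  next
    assume alt: "touch P s \<and> touch Q U2 \<and> \<not> touch Q r \<and> \<not> touch Q s"
    define W where "W = U1 \<union> Q \<union> U2"
    have W1: "enclosed W P"
      using enc alt PQ(4) unfolding enclosed_def W_def touch_def by blast
    have W2: "enclosed P (W \<union> r \<union> s \<union> {})"
      using enc(3) PQ(4) unfolding enclosed_def W_def by blast
    have "W \<noteq> {}" "W \<union> P \<union> r \<union> s \<union> {} \<subseteq> V" "W \<inter> P = {}" "(W \<union> P) \<inter> (r \<union> s \<union> {}) = {}"
      using assms(2) sub disj PQ(3,4) unfolding W_def by blast+
    \<comment> \<open>With an empty escape set only the first alternative of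
      \<open>split_ring\<close> is possible.\<close>
    from split_ring[OF this(1) W1 PQ(1) W2 this(2-4) PQ(7)] alt
    obtain P1 P2 where P12: "conn P1" "conn P2" "P1 \<inter> P2 = {}" "P1 \<union> P2 = P" "touch W P1" "touch W P2"
        "touch P1 r" "touch P2 s"
      by auto
    have U1P: "touch U1 P1 \<or> touch U1 P2"
      using PQ(5) P12(4) by auto
    \<comment> \<open>If \<open>U1\<close> misses one half and \<open>Q\<close> touches that half,
      \<open>Q\<close> joins it and brings the contact with \<open>U1\<close>. If instead
      \<open>U2\<close> touches it, \<open>Q\<close> becomes the middle set of a chain.\<close>
    consider "touch U1 P1" "touch U1 P2" | "touch U1 P1" "touch Q P2" | "touch U1 P2" "touch Q P1"
      | "touch U1 P1" "touch U2 P2" | "touch U1 P2" "touch U2 P1"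
      using U1P P12(5,6) unfolding W_def by auto
    then show ?thesis
    proof cases
      case 1
      have "finite B" "P1 \<union> P2 \<subseteq> B"
        using sub finite_V PQ(4) P12(4) by (auto intro: finite_subset)
      from conn_absorb[OF this(1) assms(1) P12(1-3) this(2)]
      obtain X Y where XY: "P1 \<subseteq> X" "P2 \<subseteq> Y" "conn X" "conn Y" "X \<inter> Y = {}" "X \<union> Y = B"
        by metis
      have "touch X r" "touch Y s" "touch U1 X" "touch U1 Y"
        using touch_mono[OF P12(7) XY(1) subset_refl] touch_mono[OF P12(8) XY(2) subset_refl]
          touch_mono[OF 1(1) subset_refl XY(1)] touch_mono[OF 1(2) subset_refl XY(2)] by simp_all
      then show ?thesis
        using XY by metis
    next
      case 2
      have "conn (P2 \<union> Q)"
        using 2 P12 PQ by (intro conn_Un) (auto simp: touch_commute)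
      then have "conn P1 \<and> conn (P2 \<union> Q) \<and> P1 \<inter> (P2 \<union> Q) = {} \<and> P1 \<union> (P2 \<union> Q) = B \<and> touch P1 r \<and>
          touch (P2 \<union> Q) s \<and> touch U1 P1 \<and> touch U1 (P2 \<union> Q)"
        using 2 P12 PQ by auto
      then show ?thesis
        by blast
    next
      case 3
      have "conn (P1 \<union> Q)"
        using 3 P12 PQ by (intro conn_Un) (auto simp: touch_commute)
      then have "conn (P1 \<union> Q) \<and> conn P2 \<and> (P1 \<union> Q) \<inter> P2 = {} \<and> (P1 \<union> Q) \<union> P2 = B \<and> touch (P1 \<union> Q) r \<and>
          touch P2 s \<and> touch U1 (P1 \<union> Q) \<and> touch U1 P2"
        using 3 P12 PQ by auto
      then show ?thesis
        by blast
    next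
      case 4
      then have "chain B r U1 U2 s"
        unfolding chain_def using P12 PQ alt
        by - (rule exI[of _ P1], rule exI[of _ Q], rule exI[of _ P2], auto simp: touch_commute)
      then show ?thesis
        by blast
    next
      case 5
      then have "chain B r U2 U1 s"
        unfolding chain_def using P12 PQ alt
        by - (rule exI[of _ P1], rule exI[of _ Q], rule exI[of _ P2], auto simp: touch_commute)
      then show ?thesis
        by blast
    qed
  qed
qed

text \<open>Once \<open>U1\<close> touches both parts \<open>X\<close> and \<open>Y\<close>, the
  case depends on \<open>U2\<close>: touching both gives a fan step at once, touching one leads to
  \<open>fork_one_sided\<close>, with \<open>r\<close> and \<open>s\<close> exchanged if that one is
  \<open>Y\<close>.\<close>

lemma fork:
  assumes "conn r" "conn s" "conn B" "U1 \<noteq> {}" "U2 \<noteq> {}"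
    and enc: "enclosed U1 B" "enclosed U2 B" "enclosed B (U1 \<union> U2 \<union> r \<union> s)"
    and disj: "U1 \<inter> U2 = {}" "r \<inter> s = {}" "B \<inter> (U1 \<union> U2) = {}" "(r \<union> s) \<inter> (B \<union> U1 \<union> U2) = {}"
    and sub: "B \<union> U1 \<union> U2 \<union> r \<union> s \<subseteq> V"
    and touch: "touch B r" "touch B s"
  shows "chain B r U1 U2 s \<or> chain B r U2 U1 s \<or> fan_step r s B U1 U2 \<or> fan_step s r B U1 U2"
proof -
  from fork_separate[OF assms(3-)] show ?thesis
  proof (elim disjE exE conjE)
    fix X Y
    assume 2: "conn X" "conn Y" "X \<inter> Y = {}" "X \<union> Y = B" "touch X r" "touch Y s" "touch U1 X" "touch U1 Y"
    have "touch U2 B"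
      by (rule touch_enclosed[OF enc(2), of r]) (use sub assms(5) disj touch(1) in auto)
    then consider "touch U2 X" "touch U2 Y" | "\<not> touch U2 Y" | "\<not> touch U2 X"
      using 2(4) by auto
    then show ?thesis
    proof cases
      case both: 1
      have sY: "conn (s \<union> Y)"
        using assms 2 by (intro conn_Un) (auto simp: touch_commute)
      have "touch X Y"
        using conn_touch[OF assms(3) 2(4,3)] 2(1,2) conn_nonempty by blast
      have "state X (s \<union> Y) U1"
        by (rule stateI[OF _ _ _ _ _ _ _ _ enc(1)])
          (use 2 disj sub sY both \<open>touch X Y\<close> in auto)
      moreover have "state X (s \<union> Y) U2"
        by (rule stateI[OF _ _ _ _ _ _ _ _ enc(2)])
          (use 2 disj sub sY both \<open>touch X Y\<close> in auto)
      ultimately have "fan_step r s B U1 U2"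
        unfolding fan_step_def using 2
        by - (rule exI[of _ X], rule exI[of _ Y], auto simp: touch_commute)
      then show ?thesis
        by blast
    next
      case only: 2
      have "enclosed U1 (X \<union> Y)" "enclosed U2 X" "enclosed X (U1 \<union> U2 \<union> Y \<union> r \<union> s)"
        using enc only 2(4) unfolding enclosed_def touch_def by blast+
      moreover have "(X \<union> Y) \<inter> (U1 \<union> U2) = {}" "(r \<union> s) \<inter> (X \<union> Y \<union> U1 \<union> U2) = {}"
          "X \<union> Y \<union> U1 \<union> U2 \<union> r \<union> s \<subseteq> V"
        using disj sub 2(4) by blast+
      ultimately have "chain (X \<union> Y) r U2 U1 s \<or> fan_step r s (X \<union> Y) U1 U2"
        by (intro fork_one_sided assms(1,2,4,5) disj(1,2) 2)
      then show ?thesis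
        using 2(4) by auto
    next
      case only: 3
      have "enclosed U1 (Y \<union> X)" "enclosed U2 Y" "enclosed Y (U1 \<union> U2 \<union> X \<union> s \<union> r)"
        using enc only 2(4) unfolding enclosed_def touch_def by blast+
      moreover have "(Y \<union> X) \<inter> (U1 \<union> U2) = {}" "(s \<union> r) \<inter> (Y \<union> X \<union> U1 \<union> U2) = {}"
          "Y \<union> X \<union> U1 \<union> U2 \<union> s \<union> r \<subseteq> V" "Y \<inter> X = {}" "s \<inter> r = {}" "Y \<union> X = B"
        using disj sub 2(3,4) by blast+
      ultimately show ?thesis
        using fork_one_sided[OF assms(2,1) 2(2,1) assms(4,5)] 2(5-8) chain_rev disj(1) by metis
    qed
  qed blast+
qed

text \<open>The ring half \<open>P1\<close> touches both \<open>A\<close> and \<open>M\<close>, so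
  it fuses them, together with \<open>Q2\<close>, into one tree node; \<open>Q1\<close> and
  \<open>P2\<close> join the apex through \<open>C\<close>. Each of \<open>W1\<close>,
  \<open>W2\<close> has one half of its ring on either side.\<close>

lemma fan_step_of_rings:
  assumes conn: "conn s" "conn A" "conn M" "conn C" "conn P1" "conn Q1" "conn P2" "conn Q2" "conn (P2 \<union> Q2)"
    and enc: "enclosed W1 (P1 \<union> Q1)" "enclosed W2 (P2 \<union> Q2)"
    and disj: "A \<inter> M = {}" "(A \<union> M) \<inter> C = {}" "(A \<union> M \<union> C) \<inter> (P1 \<union> Q1 \<union> W1 \<union> P2 \<union> Q2 \<union> W2) = {}"
      "(P1 \<union> Q1 \<union> W1) \<inter> (P2 \<union> Q2 \<union> W2) = {}" "P1 \<inter> Q1 = {}" "P2 \<inter> Q2 = {}"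
      "(P1 \<union> Q1) \<inter> W1 = {}" "(P2 \<union> Q2) \<inter> W2 = {}"
      "s \<inter> (A \<union> M \<union> C \<union> P1 \<union> Q1 \<union> W1 \<union> P2 \<union> Q2 \<union> W2) = {}"
    and sub: "s \<union> A \<union> M \<union> C \<union> P1 \<union> Q1 \<union> P2 \<union> Q2 \<subseteq> V"
    and touch: "touch r A" "touch C s" "touch P1 A" "touch P1 M" "touch Q1 C" "touch P2 C" "touch Q2 M"
      "touch W1 P1" "touch W1 Q1" "touch W2 P2" "touch W2 Q2"
  shows "fan_step r s (A \<union> M \<union> C \<union> P1 \<union> Q1 \<union> P2 \<union> Q2) W1 W2"
proof -
  define X where "X = A \<union> P1 \<union> M \<union> Q2"
  define Y where "Y = C \<union> Q1 \<union> P2"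
  have touch': "touch A P1" "touch C Q1" "touch C P2" "touch M Q2" "touch s C"
    using touch by (simp_all add: touch_commute)
  have X: "conn X"
    unfolding X_def by (intro conn_Un conn) (use touch touch' in auto)
  have "conn (C \<union> Q1 \<union> P2)"
    by (intro conn_Un conn) (use touch' in auto)
  then have Y: "conn (s \<union> Y)"
    unfolding Y_def by (rule conn_Un[OF conn(1)]) (use touch' in auto)
  have "touch P2 Q2"
    by (rule conn_touch[OF conn(9)]) (use conn(7,8) conn_nonempty disj(6) in auto)
  then have XY: "touch X (s \<union> Y)"
    unfolding X_def Y_def by (simp add: touch_commute)
  have XY': "X \<inter> (s \<union> Y) = {}" "X \<union> (s \<union> Y) \<subseteq> V"
    using disj sub unfolding X_def Y_def by (simp_all add: Int_Un_distrib Int_Un_distrib2 Int_commute)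
  have "state X (s \<union> Y) W1"
    by (rule stateI[OF X Y XY'(1) _ XY'(2) XY _ _ enc(1)])
      (use disj touch in \<open>simp_all add: X_def Y_def Int_Un_distrib Int_Un_distrib2 Int_commute le_supI1 le_supI2\<close>)
  moreover have "state X (s \<union> Y) W2"
    by (rule stateI[OF X Y XY'(1) _ XY'(2) XY _ _ enc(2)])
      (use disj touch in \<open>simp_all add: X_def Y_def Int_Un_distrib Int_Un_distrib2 Int_commute le_supI1 le_supI2\<close>)
  ultimately show ?thesis
    unfolding fan_step_def using touch(1)
    by - (rule exI[of _ X], rule exI[of _ Y], auto simp: X_def Y_def)
qed

text \<open>Each ring half joins the chain set that it touches. The two halves of a connected ring
  touch each other, which supplies the edges \<open>A M\<close> and \<open>M C\<close> missing in a
  chain.\<close>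

lemma nabla_step_of_rings:
  assumes conn: "conn r" "conn s" "conn A" "conn M" "conn C" "conn P1" "conn Q1" "conn P2" "conn Q2"
      "conn (P1 \<union> Q1)" "conn (P2 \<union> Q2)"
    and enc: "enclosed W1 (P1 \<union> Q1)" "enclosed W2 (P2 \<union> Q2)"
    and disj: "A \<inter> M = {}" "(A \<union> M) \<inter> C = {}" "(A \<union> M \<union> C) \<inter> (P1 \<union> Q1 \<union> W1 \<union> P2 \<union> Q2 \<union> W2) = {}"
      "(P1 \<union> Q1 \<union> W1) \<inter> (P2 \<union> Q2 \<union> W2) = {}" "P1 \<inter> Q1 = {}" "P2 \<inter> Q2 = {}"
      "(P1 \<union> Q1) \<inter> W1 = {}" "(P2 \<union> Q2) \<inter> W2 = {}" "r \<inter> s = {}"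
      "(r \<union> s) \<inter> (A \<union> M \<union> C \<union> P1 \<union> Q1 \<union> W1 \<union> P2 \<union> Q2 \<union> W2) = {}"
    and sub: "r \<union> s \<union> A \<union> M \<union> C \<union> P1 \<union> Q1 \<union> P2 \<union> Q2 \<subseteq> V"
    and touch: "touch r A" "touch C s" "touch P1 A" "touch Q1 M" "touch P2 C" "touch Q2 M"
      "touch W1 P1" "touch W1 Q1" "touch W2 P2" "touch W2 Q2"
  shows "nabla_step r s (A \<union> M \<union> C \<union> P1 \<union> Q1 \<union> P2 \<union> Q2) W1 W2"
proof -
  define A' where "A' = A \<union> P1"
  define M' where "M' = M \<union> Q1 \<union> Q2"
  define C' where "C' = C \<union> P2"
  have touch': "touch A P1" "touch C P2" "touch M Q1" "touch M Q2" "touch s C"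
    using touch by (simp_all add: touch_commute)
  have "conn (A \<union> P1)" "conn (C \<union> P2)"
    by (intro conn_Un conn touch')+
  then have A': "conn (r \<union> A')" and C': "conn (s \<union> C')"
    unfolding A'_def C'_def by (intro conn_Un conn; use touch touch' in auto)+
  have M': "conn M'"
    unfolding M'_def by (intro conn_Un conn) (use touch' in auto)
  have "touch P1 Q1"
    by (rule conn_touch[OF conn(10)]) (use conn(6,7) conn_nonempty disj(5) in auto)
  then have AM: "touch (r \<union> A') M'"
    unfolding A'_def M'_def by simp
  have "touch P2 Q2"
    by (rule conn_touch[OF conn(11)]) (use conn(8,9) conn_nonempty disj(6) in auto)
  then have MC: "touch M' (s \<union> C')"
    unfolding C'_def M'_def by (simp add: touch_commute)
  have AM': "(r \<union> A') \<inter> M' = {}" "r \<union> A' \<union> M' \<subseteq> V"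
    and MC': "M' \<inter> (s \<union> C') = {}" "M' \<union> (s \<union> C') \<subseteq> V"
    using disj sub unfolding A'_def M'_def C'_def
    by (simp_all add: Int_Un_distrib Int_Un_distrib2 Int_commute)
  have "state (r \<union> A') M' W1"
    by (rule stateI[OF A' M' AM'(1) _ AM'(2) AM _ _ enc(1)])
      (use disj touch in \<open>simp_all add: A'_def M'_def Int_Un_distrib Int_Un_distrib2 Int_commute le_supI1 le_supI2\<close>)
  moreover have "state M' (s \<union> C') W2"
    by (rule stateI[OF M' C' MC'(1) _ MC'(2) MC _ _ enc(2)])
      (use disj touch in \<open>simp_all add: C'_def M'_def Int_Un_distrib Int_Un_distrib2 Int_commute le_supI1 le_supI2\<close>)
  moreover have "(r \<union> A') \<inter> (s \<union> C') = {}" "A' \<inter> W2 = {}" "C' \<inter> W1 = {}"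
    using disj unfolding A'_def C'_def by (simp_all add: Int_Un_distrib Int_Un_distrib2 Int_commute)
  ultimately show ?thesis
    unfolding nabla_step_def
    by - (rule exI[of _ A'], rule exI[of _ M'], rule exI[of _ C'], auto simp: A'_def M'_def C'_def)
qed

text \<open>Each ring is split with respect to its two chain sets, the far chain set being the
  escape. The outcome depends on which rings escape: none or both give a nabla step, exactly one
  gives a fan step.\<close>

lemma chain_step:
  assumes chain: "chain B r (R1 \<union> W1) (R2 \<union> W2) s"
    and conn: "conn r" "conn s" "conn R1" "conn R2" "W1 \<noteq> {}" "W2 \<noteq> {}"
    and enc: "enclosed W1 R1" "enclosed W2 R2" "enclosed R1 (W1 \<union> B)" "enclosed R2 (W2 \<union> B)"
    and disj: "B \<inter> (R1 \<union> W1 \<union> R2 \<union> W2) = {}" "(R1 \<union> W1) \<inter> (R2 \<union> W2) = {}" "R1 \<inter> W1 = {}" "R2 \<inter> W2 = {}"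
      "r \<inter> s = {}" "(r \<union> s) \<inter> (B \<union> R1 \<union> W1 \<union> R2 \<union> W2) = {}"
    and sub: "r \<union> s \<union> B \<union> R1 \<union> W1 \<union> R2 \<union> W2 \<subseteq> V"
  shows "nabla_step r s (B \<union> R1 \<union> R2) W1 W2 \<or> nabla_step r s (B \<union> R1 \<union> R2) W2 W1 \<or>
    fan_step r s (B \<union> R1 \<union> R2) W1 W2 \<or> fan_step s r (B \<union> R1 \<union> R2) W2 W1"
proof -
  obtain A M C where AMC: "conn A" "conn M" "conn C" "A \<inter> M = {}" "A \<inter> C = {}" "M \<inter> C = {}" "A \<union> M \<union> C = B"
      "touch r A" "touch A (R1 \<union> W1)" "touch (R1 \<union> W1) M" "touch M (R2 \<union> W2)" "touch (R2 \<union> W2) C" "touch C s"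
    using chain unfolding chain_def by metis
  have "\<not> touch W1 B" "\<not> touch W2 B"
    by (rule enclosed_not_touch[OF enc(1)], use disj(1) in blast)
      (rule enclosed_not_touch[OF enc(2)], use disj(1) in blast)
  then have RT: "touch R1 A" "touch R1 M" "touch R2 C" "touch R2 M"
    using AMC(9-12) unfolding AMC(7)[symmetric] by (auto simp: touch_commute)
  have "enclosed R1 (W1 \<union> A \<union> M \<union> C)" "W1 \<union> R1 \<union> A \<union> M \<union> C \<subseteq> V" "W1 \<inter> R1 = {}"
      "(W1 \<union> R1) \<inter> (A \<union> M \<union> C) = {}"
    using enc(3) sub disj unfolding AMC(7)[symmetric] by (auto simp: Un_assoc)
  from split_ring[OF conn(5) enc(1) conn(3) this RT(1,2)]
  obtain P1 Q1 where R1: "conn P1" "conn Q1" "P1 \<inter> Q1 = {}" "P1 \<union> Q1 = R1" "touch W1 P1" "touch W1 Q1" "touch P1 A"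
    and alt1: "touch Q1 M \<or> touch P1 M \<and> touch Q1 C"
    by metis
  have "enclosed R2 (W2 \<union> C \<union> M \<union> A)" "W2 \<union> R2 \<union> C \<union> M \<union> A \<subseteq> V" "W2 \<inter> R2 = {}"
      "(W2 \<union> R2) \<inter> (C \<union> M \<union> A) = {}"
    using enc(4) sub disj unfolding AMC(7)[symmetric] by (auto simp: Un_ac)
  from split_ring[OF conn(6) enc(2) conn(4) this RT(3,4)]
  obtain P2 Q2 where R2: "conn P2" "conn Q2" "P2 \<inter> Q2 = {}" "P2 \<union> Q2 = R2" "touch W2 P2" "touch W2 Q2" "touch P2 C"
    and alt2: "touch Q2 M \<or> touch P2 M \<and> touch Q2 A"
    by metis
  have d: "A \<inter> M = {}" "(A \<union> M) \<inter> C = {}" "M \<inter> C = {}" "(C \<union> M) \<inter> A = {}" "C \<inter> M = {}"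
    using AMC by blast+
  note rw = AMC(7)[symmetric] R1(4)[symmetric] R2(4)[symmetric]
  have enc': "enclosed W1 (P1 \<union> Q1)" "enclosed W2 (P2 \<union> Q2)" "enclosed W1 (Q1 \<union> P1)" "enclosed W2 (Q2 \<union> P2)"
    and conn': "conn (P1 \<union> Q1)" "conn (P2 \<union> Q2)" "conn (Q1 \<union> P1)" "conn (Q2 \<union> P2)"
    using enc conn R1(4) R2(4) by (auto simp: Un_commute)
  have swap: "touch s C" "touch A r"
    using AMC by (auto simp: touch_commute)
  consider "touch Q1 M" "touch Q2 M" | "touch P1 M" "touch Q1 C" "touch Q2 M" | "touch Q1 M" "touch P2 M" "touch Q2 A"
    | "touch P1 M" "touch Q1 C" "touch P2 M" "touch Q2 A"
    using alt1 alt2 by metis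
  then show ?thesis
  proof cases
    case 1
    have "nabla_step r s (A \<union> M \<union> C \<union> P1 \<union> Q1 \<union> P2 \<union> Q2) W1 W2"
      by (rule nabla_step_of_rings[OF conn(1,2) AMC(1-3) R1(1,2) R2(1,2) conn'(1,2) enc'(1,2) d(1,2)])
        (use disj sub AMC(8,13) R1(3,5-7) R2(3,5-7) 1 in \<open>simp_all add: rw Int_Un_distrib Int_Un_distrib2 Int_commute\<close>)
    then show ?thesis
      unfolding rw by (simp add: Un_assoc)
  next
    case 2
    have "fan_step r s (A \<union> M \<union> C \<union> P1 \<union> Q1 \<union> P2 \<union> Q2) W1 W2"
      by (rule fan_step_of_rings[OF conn(2) AMC(1-3) R1(1,2) R2(1,2) conn'(2) enc'(1,2) d(1,2)])
        (use disj sub AMC(8,13) R1(3,5-7) R2(3,5-7) 2 in \<open>simp_all add: rw Int_Un_distrib Int_Un_distrib2 Int_commute\<close>)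
    then show ?thesis
      unfolding rw by (simp add: Un_assoc)
  next
    case 3
    have "fan_step s r (C \<union> M \<union> A \<union> P2 \<union> Q2 \<union> P1 \<union> Q1) W2 W1"
      by (rule fan_step_of_rings[OF conn(1) AMC(3,2,1) R2(1,2) R1(1,2) conn'(1) enc'(2,1) d(5,4)])
        (use disj sub swap R1(3,5-7) R2(3,5-7) 3 in \<open>simp_all add: rw Int_Un_distrib Int_Un_distrib2 Int_commute\<close>)
    moreover have "C \<union> M \<union> A \<union> P2 \<union> Q2 \<union> P1 \<union> Q1 = B \<union> R1 \<union> R2"
      unfolding rw by blast
    ultimately show ?thesis
      by simp
  next
    case 4
    \<comment> \<open>Both rings escape, so the subtrees exchange places: \<open>W2\<close> now lies
      between \<open>A\<close> and \<open>M\<close>, and \<open>W1\<close> between \<open>M\<close>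
      and \<open>C\<close>.\<close>
    have "nabla_step r s (A \<union> M \<union> C \<union> Q2 \<union> P2 \<union> Q1 \<union> P1) W2 W1"
      by (rule nabla_step_of_rings[OF conn(1,2) AMC(1-3) R2(2,1) R1(2,1) conn'(4,3) enc'(4,3) d(1,2)])
        (use disj sub AMC(8,13) R1(3,5-7) R2(3,5-7) 4 in \<open>simp_all add: rw Int_Un_distrib Int_Un_distrib2 Int_commute\<close>)
    moreover have "A \<union> M \<union> C \<union> Q2 \<union> P2 \<union> Q1 \<union> P1 = B \<union> R1 \<union> R2"
      unfolding rw by blast
    ultimately show ?thesis
      by simp
  qed
qed

end

section \<open>Rooted apex trees and rooted nablas\<close>

context biconnected
begin

definition tree_model :: "nat \<Rightarrow> (bool list \<Rightarrow> 'a set) \<Rightarrow> bool" where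
  "tree_model i T \<longleftrightarrow> (\<forall>xs. length xs \<le> i \<longrightarrow> conn (T xs) \<and> T xs \<subseteq> V) \<and>
     (\<forall>xs ys. length xs \<le> i \<and> length ys \<le> i \<and> xs \<noteq> ys \<longrightarrow> T xs \<inter> T ys = {}) \<and>
     (\<forall>b xs. length xs < i \<longrightarrow> touch (T xs) (T (b # xs)))"

definition apex_tree :: "nat \<Rightarrow> bool" where
  "apex_tree i \<longleftrightarrow> (\<exists>T Z. tree_model i T \<and> conn Z \<and> Z \<subseteq> V \<and>
     (\<forall>xs. length xs \<le> i \<longrightarrow> T xs \<inter> Z = {}) \<and> (\<forall>xs. length xs = i \<longrightarrow> touch (T xs) Z))"

lemma fan_step_mono: "fan_step r s U Z Z' \<Longrightarrow> U \<subseteq> U' \<Longrightarrow> fan_step r s U' Z Z'"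
  unfolding fan_step_def by (meson subset_trans)

lemma nabla_step_mono: "nabla_step r s U Z Z' \<Longrightarrow> U \<subseteq> U' \<Longrightarrow> nabla_step r s U' Z Z'"
  unfolding nabla_step_def by (meson subset_trans)

text \<open>The apex may grow from \<open>s\<close> into \<open>U\<close> by \<open>Y\<close>,
  whereas \<open>r\<close> stays outside the tree and only touches its root; so two such trees can
  hang from the same \<open>r\<close> and share the apex.\<close>

definition rooted_apex_tree :: "nat \<Rightarrow> 'a set \<Rightarrow> 'a set \<Rightarrow> 'a set \<Rightarrow> bool" where
  "rooted_apex_tree i r s U \<longleftrightarrow> (\<exists>T Y. tree_model i T \<and> Y \<subseteq> U \<and>
     (\<forall>xs. length xs \<le> i \<longrightarrow> T xs \<subseteq> U - Y) \<and> conn (s \<union> Y) \<and> touch (T []) r \<and>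
     (\<forall>xs. length xs = i \<longrightarrow> touch (T xs) (s \<union> Y)))"

text \<open>The end sets may outgrow \<open>r\<close> and \<open>s\<close>, but only into
  \<open>U\<close>; so two models glued at a common middle set stay disjoint elsewhere.\<close>

definition nabla_model :: "nat \<Rightarrow> 'a set \<Rightarrow> 'a set \<Rightarrow> 'a set \<Rightarrow> (nat \<Rightarrow> 'a set) \<Rightarrow> bool" where
  "nabla_model h r s U f \<longleftrightarrow> (\<forall>i \<le> 2 ^ h. conn (f i)) \<and>
     (\<forall>i j. i \<le> 2 ^ h \<and> j \<le> 2 ^ h \<and> i \<noteq> j \<longrightarrow> f i \<inter> f j = {}) \<and>
     (\<forall>i j. (i, j) \<in> parcs (nabla h) \<longrightarrow> touch (f i) (f j)) \<and>
     r \<subseteq> f 0 \<and> s \<subseteq> f (2 ^ h) \<and> f 0 \<subseteq> r \<union> U \<and> f (2 ^ h) \<subseteq> s \<union> U \<and>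
     (\<forall>i. 0 < i \<and> i < 2 ^ h \<longrightarrow> f i \<subseteq> U)"

definition rooted_nabla :: "nat \<Rightarrow> 'a set \<Rightarrow> 'a set \<Rightarrow> 'a set \<Rightarrow> bool" where
  "rooted_nabla h r s U \<longleftrightarrow> (\<exists>f. nabla_model h r s U f)"

lemma nabla_modelD:
  assumes "nabla_model h r s U f"
  shows "\<And>i. i \<le> 2 ^ h \<Longrightarrow> conn (f i)" "\<And>i j. i \<le> 2 ^ h \<Longrightarrow> j \<le> 2 ^ h \<Longrightarrow> i \<noteq> j \<Longrightarrow> f i \<inter> f j = {}"
    "\<And>i j. (i, j) \<in> parcs (nabla h) \<Longrightarrow> touch (f i) (f j)"
    "r \<subseteq> f 0" "s \<subseteq> f (2 ^ h)" "f 0 \<subseteq> r \<union> U" "f (2 ^ h) \<subseteq> s \<union> U" "\<And>i. 0 < i \<Longrightarrow> i < 2 ^ h \<Longrightarrow> f i \<subseteq> U"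
  using assms unfolding nabla_model_def by simp_all

lemma apex_tree_if_rooted:
  assumes "rooted_apex_tree i r s U" "U \<subseteq> V" "s \<subseteq> V" "s \<inter> U = {}"
  shows "apex_tree i"
proof -
  obtain T Y where T: "tree_model i T" "Y \<subseteq> U" "\<And>xs. length xs \<le> i \<Longrightarrow> T xs \<subseteq> U - Y" "conn (s \<union> Y)"
      "\<And>xs. length xs = i \<Longrightarrow> touch (T xs) (s \<union> Y)"
    using assms(1) unfolding rooted_apex_tree_def by blast
  have "T xs \<inter> (s \<union> Y) = {}" if "length xs \<le> i" for xs
    using T(3)[OF that] assms(4) by blast
  moreover have "s \<union> Y \<subseteq> V"
    using T(2) assms by blast
  ultimately show ?thesis
    unfolding apex_tree_def using T(1,4,5) by (intro exI[of _ T] exI[of _ "s \<union> Y"]) blast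
qed

lemma rooted_apex_tree_0:
  assumes "conn U" "U \<subseteq> V" "state r s U"
  shows "rooted_apex_tree 0 r s U"
  unfolding rooted_apex_tree_def tree_model_def using assms
  by (intro exI[of _ "\<lambda>_. U"] exI[of _ "{}"]) (auto simp: state_def)

text \<open>The apex simply absorbs \<open>Q\<close>. The root of the tree, which so far may reach
  only \<open>P\<close>, is prolonged inside \<open>P\<close> to \<open>r\<close> by
  \<open>conn_extend\<close>.\<close>

lemma rooted_apex_tree_extend:
  assumes "rooted_apex_tree i r' s' U'" "U' \<subseteq> U" "P \<union> Q \<subseteq> U - U'" "P \<inter> Q = {}" "U \<subseteq> V"
    and "r' \<subseteq> r \<union> P" "s' \<subseteq> s \<union> Q" "conn (r \<union> P)" "conn (s \<union> Q)" "r \<inter> U = {}" "r \<noteq> {}" "s' \<noteq> {}"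
  shows "rooted_apex_tree i r s U"
proof -
  obtain T Y where T: "tree_model i T" "Y \<subseteq> U'" "\<And>xs. length xs \<le> i \<Longrightarrow> T xs \<subseteq> U' - Y" "conn (s' \<union> Y)"
      "touch (T []) r'" "\<And>xs. length xs = i \<Longrightarrow> touch (T xs) (s' \<union> Y)"
    using assms(1) unfolding rooted_apex_tree_def by blast
  have fin: "finite P"
    using assms finite_V by (meson Diff_subset finite_subset le_sup_iff subset_trans)
  have T0: "conn (T [])" "T [] \<subseteq> U' - Y"
    using T(1,3) unfolding tree_model_def by simp_all
  have "touch (T []) (r \<union> P)"
    using touch_mono[OF T(5) subset_refl assms(6)] .
  moreover have "r \<inter> (T [] \<union> P) = {}"
    using T0(2) assms by blast
  ultimately obtain P' where P': "P' \<subseteq> P" "conn (T [] \<union> P')" "touch (T [] \<union> P') r"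
    using conn_extend[OF fin assms(8,11) T0(1)] by blast
  define T' where "T' = T([] := T [] \<union> P')"
  have T': "T xs \<subseteq> T' xs" for xs
    unfolding T'_def by simp
  have P'U: "P' \<subseteq> U - U'"
    using P' assms by blast
  have "T' xs \<subseteq> U - (Q \<union> Y)" if "length xs \<le> i" for xs
    using T(2) T(3)[OF that] P'(1) assms(2-4) unfolding T'_def by auto
  moreover have "tree_model i T'"
    unfolding tree_model_def
  proof (intro conjI allI impI)
    fix xs :: "bool list" assume "length xs \<le> i"
    then show "conn (T' xs)" "T' xs \<subseteq> V"
      using T(1) P' assms unfolding tree_model_def T'_def by auto
  next
    fix xs ys :: "bool list" assume *: "length xs \<le> i \<and> length ys \<le> i \<and> xs \<noteq> ys"
    then have "T xs \<inter> T ys = {}" "T xs \<subseteq> U'" "T ys \<subseteq> U'"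
      using T(1) T(3)[of xs] T(3)[of ys] unfolding tree_model_def by auto
    then show "T' xs \<inter> T' ys = {}"
      using P'U * unfolding T'_def by auto
  next
    fix b and xs :: "bool list" assume "length xs < i"
    then have "touch (T xs) (T (b # xs))"
      using T(1) unfolding tree_model_def by blast
    then show "touch (T' xs) (T' (b # xs))"
      by (rule touch_mono[OF _ T' T'])
  qed
  moreover have "Q \<union> Y \<subseteq> U"
    using T(2) assms by blast
  moreover have "conn (s \<union> (Q \<union> Y))"
  proof -
    have "conn ((s \<union> Q) \<union> (s' \<union> Y))"
      by (rule conn_Un_overlap[OF assms(9) T(4)]) (use assms(7,12) in blast)
    moreover have "(s \<union> Q) \<union> (s' \<union> Y) = s \<union> (Q \<union> Y)"
      using assms(7) by blast
    ultimately show ?thesis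
      by simp
  qed
  moreover have "touch (T' []) r"
    using P' unfolding T'_def by simp
  moreover have "touch (T' xs) (s \<union> (Q \<union> Y))" if "length xs = i" for xs
    by (rule touch_mono[OF T(6)[OF that] T']) (use assms(7) in blast)
  ultimately show ?thesis
    unfolding rooted_apex_tree_def by blast
qed

text \<open>Both trees hang from \<open>X\<close>, which becomes the new root, and their apices
  overlap in \<open>s'\<close>, so they merge into one.\<close>

lemma rooted_apex_tree_Suc:
  assumes "rooted_apex_tree i X s' Z" "rooted_apex_tree i X s' Z'" "s' = s \<union> Y"
    and "X \<union> Y \<union> Z \<union> Z' \<subseteq> U" "Z \<inter> Z' = {}" "(X \<union> Y) \<inter> (Z \<union> Z') = {}" "X \<inter> s' = {}"
    and "conn X" "touch X r" "conn s'" "U \<subseteq> V"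
  shows "rooted_apex_tree (Suc i) r s U"
proof -
  obtain T1 Y1 where T1: "tree_model i T1" "Y1 \<subseteq> Z" "\<And>xs. length xs \<le> i \<Longrightarrow> T1 xs \<subseteq> Z - Y1" "conn (s' \<union> Y1)"
      "touch (T1 []) X" "\<And>xs. length xs = i \<Longrightarrow> touch (T1 xs) (s' \<union> Y1)"
    using assms(1) unfolding rooted_apex_tree_def by blast
  obtain T2 Y2 where T2: "tree_model i T2" "Y2 \<subseteq> Z'" "\<And>xs. length xs \<le> i \<Longrightarrow> T2 xs \<subseteq> Z' - Y2" "conn (s' \<union> Y2)"
      "touch (T2 []) X" "\<And>xs. length xs = i \<Longrightarrow> touch (T2 xs) (s' \<union> Y2)"
    using assms(2) unfolding rooted_apex_tree_def by blast
  define Tb where "Tb = (\<lambda>b. if b then T2 else T1)"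
  define Zb where "Zb = (\<lambda>b. if b then Z' else Z)"
  \<comment> \<open>Nodes list the most recent choice first, so the choice made at the root is the
    last entry: \<open>last\<close> selects the subtree and \<open>butlast\<close> the node in
    it.\<close>
  define T where "T = (\<lambda>xs. if xs = [] then X else Tb (last xs) (butlast xs))"
  define Y' where "Y' = Y \<union> Y1 \<union> Y2"
  have T_simps: "T [] = X" "T (xs @ [b]) = Tb b xs" for xs b
    unfolding T_def by simp_all
  have Tb: "tree_model i (Tb b)" "touch (Tb b []) X" "length xs \<le> i \<Longrightarrow> Tb b xs \<subseteq> Zb b - Y'"
      "length xs = i \<Longrightarrow> touch (Tb b xs) (s \<union> Y')" for b xs
  proof -
    show "tree_model i (Tb b)" "touch (Tb b []) X"
      using T1 T2 unfolding Tb_def by auto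
    show "Tb b xs \<subseteq> Zb b - Y'" if "length xs \<le> i"
      using T1(2) T2(2) T1(3)[OF that] T2(3)[OF that] assms(5,6) unfolding Tb_def Zb_def Y'_def by (cases b) auto
    show "touch (Tb b xs) (s \<union> Y')" if "length xs = i"
      using T1(6)[OF that] T2(6)[OF that] assms(3) unfolding Tb_def Y'_def by auto
  qed
  have nodes: "xs = [] \<or> (\<exists>ys b. xs = ys @ [b] \<and> length ys \<le> i)" if "length xs \<le> Suc i" for xs :: "bool list"
    using that by (cases xs rule: rev_cases) auto
  have Zb: "Zb b \<inter> X = {}" "Zb b \<subseteq> U" "b \<noteq> c \<Longrightarrow> Zb b \<inter> Zb c = {}" for b c
    using assms unfolding Zb_def by auto
  have XY': "X \<inter> Y' = {}"
    using T1(2) T2(2) assms unfolding Y'_def by blast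
  have sub: "T xs \<subseteq> U - Y'" if "length xs \<le> Suc i" for xs
    using nodes[OF that]
  proof (elim disjE exE conjE)
    fix ys b assume "xs = ys @ [b]" "length ys \<le> i"
    then show ?thesis
      using Tb(3)[of ys b] Zb(2)[of b] T_simps(2) by auto
  qed (use XY' assms(4) T_simps(1) in auto)
  moreover have "tree_model (Suc i) T"
    unfolding tree_model_def
  proof (intro conjI allI impI)
    fix xs :: "bool list" assume xs: "length xs \<le> Suc i"
    then show "conn (T xs)"
      using nodes[OF xs] Tb(1) assms(8) by (auto simp: T_simps tree_model_def)
    show "T xs \<subseteq> V"
      using sub[OF xs] assms(11) by blast
  next
    fix xs ys :: "bool list" assume *: "length xs \<le> Suc i \<and> length ys \<le> Suc i \<and> xs \<noteq> ys"
    have X_Tb: "X \<inter> Tb b us = {}" if "length us \<le> i" for b us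
      using Tb(3)[OF that] Zb(1) by blast
    have Tb_Tb: "Tb b us \<inter> Tb c vs = {}" if "length us \<le> i" "length vs \<le> i" "us @ [b] \<noteq> vs @ [c]" for b c us vs
    proof (cases "b = c")
      case True
      then show ?thesis
        using that Tb(1)[of b] unfolding tree_model_def by auto
    next
      case False
      then show ?thesis
        using that Tb(3)[of us b] Tb(3)[of vs c] Zb(3)[of b c] by blast
    qed
    have "xs = [] \<or> (\<exists>us b. xs = us @ [b] \<and> length us \<le> i)" "ys = [] \<or> (\<exists>us b. ys = us @ [b] \<and> length us \<le> i)"
      using nodes * by blast+
    then show "T xs \<inter> T ys = {}"
    proof (elim disjE exE conjE)
      fix us b assume "xs = []" "ys = us @ [b]" "length us \<le> i"
      then show ?thesis
        using X_Tb T_simps by simp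
    next
      fix us b assume "ys = []" "xs = us @ [b]" "length us \<le> i"
      then show ?thesis
        using X_Tb[of us b] T_simps by (simp add: Int_commute)
    next
      fix us b vs c assume "xs = us @ [b]" "length us \<le> i" "ys = vs @ [c]" "length vs \<le> i"
      then show ?thesis
        using Tb_Tb[of us vs b c] * T_simps(2) by simp
    qed (use * in simp)
  next
    fix b and xs :: "bool list" assume xs: "length xs < Suc i"
    show "touch (T xs) (T (b # xs))"
    proof (cases xs rule: rev_cases)
      case Nil
      then show ?thesis
        using T_simps(2)[of "[]" b] Tb(2) T_simps(1) by (simp add: touch_commute)
    next
      case (snoc ys c)
      then have "touch (Tb c ys) (Tb c (b # ys))"
        using xs Tb(1)[of c] unfolding tree_model_def by auto
      then show ?thesis
        using snoc T_simps(2)[of ys c] T_simps(2)[of "b # ys" c] by simp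
    qed
  qed
  moreover have "Y' \<subseteq> U"
    using T1(2) T2(2) assms(4) unfolding Y'_def by blast
  moreover have "conn (s \<union> Y')"
  proof -
    have "conn ((s' \<union> Y1) \<union> (s' \<union> Y2))"
      by (rule conn_Un_overlap[OF T1(4) T2(4)]) (use conn_nonempty[OF assms(10)] in blast)
    moreover have "(s' \<union> Y1) \<union> (s' \<union> Y2) = s \<union> Y'"
      unfolding Y'_def assms(3) by blast
    ultimately show ?thesis
      by simp
  qed
  moreover have "touch (T xs) (s \<union> Y')" if "length xs = Suc i" for xs
  proof -
    obtain ys b where "xs = ys @ [b]" "length ys = i"
      using \<open>length xs = Suc i\<close> by (cases xs rule: rev_cases) auto
    then show ?thesis
      using Tb(4) T_simps(2) by simp
  qed
  ultimately show ?thesis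
    unfolding rooted_apex_tree_def using assms(9) T_simps(1)
    by (intro exI[of _ T] exI[of _ Y']) simp
qed

text \<open>As \<open>nabla 0\<close> is a single edge, the recursion is uniform from height 0 on,
  and the inductions below can start with the edge between \<open>r\<close> and
  \<open>s\<close>.\<close>

lemma parcs_nabla_Suc:
  "parcs (nabla (Suc h)) = parcs (nabla h) \<union> map_prod (\<lambda>x. x + 2 ^ h) (\<lambda>x. x + 2 ^ h) ` parcs (nabla h) \<union>
     {(0, 2 ^ Suc h), (2 ^ Suc h, 0)}"
  by (cases h) (auto simp: Let_def)

lemma parcs_nabla_bound: "(i, j) \<in> parcs (nabla h) \<Longrightarrow> i \<le> 2 ^ h \<and> j \<le> 2 ^ h"
proof -
  assume *: "(i, j) \<in> parcs (nabla h)"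
  interpret pair_graph "nabla h"
    by (rule pair_graph_nabla)
  show ?thesis
    using in_arcsD1[OF *] in_arcsD2[OF *] pverts_nabla[of h] by simp
qed

lemma rooted_nabla_0: "state r s U \<Longrightarrow> rooted_nabla 0 r s U"
  unfolding rooted_nabla_def nabla_model_def state_def
  by (intro exI[of _ "\<lambda>i. if i = 0 then r else s"]) (auto simp: touch_commute le_Suc_eq)

text \<open>No rerouting as for trees: \<open>P\<close> and \<open>Q\<close> are absorbed by the two
  end sets, which are allowed to grow.\<close>

lemma rooted_nabla_extend:
  assumes "rooted_nabla h r' s' U'" "U' \<subseteq> U" "P \<union> Q \<subseteq> U - U'" "P \<inter> Q = {}"
    and "r' \<subseteq> r \<union> P" "s' \<subseteq> s \<union> Q" "conn (r \<union> P)" "conn (s \<union> Q)"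
    and "r \<inter> s = {}" "(r \<union> s) \<inter> U = {}" "r' \<noteq> {}" "s' \<noteq> {}"
  shows "rooted_nabla h r s U"
proof -
  obtain f where "nabla_model h r' s' U' f"
    using assms(1) unfolding rooted_nabla_def by blast
  note f = nabla_modelD[OF this]
  define g where "g = f(0 := f 0 \<union> (r \<union> P), 2 ^ h := f (2 ^ h) \<union> (s \<union> Q))"
  have g: "g 0 = f 0 \<union> (r \<union> P)" "g (2 ^ h) = f (2 ^ h) \<union> (s \<union> Q)" "\<And>i. i \<noteq> 0 \<Longrightarrow> i \<noteq> 2 ^ h \<Longrightarrow> g i = f i"
    unfolding g_def by auto
  have fg: "f i \<subseteq> g i" for i
    unfolding g_def by auto
  have "conn (f 0 \<union> (r \<union> P))" "conn (f (2 ^ h) \<union> (s \<union> Q))"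
    by (rule conn_Un_overlap[OF f(1)[of 0] assms(7)]; use f(4) assms(5,11) in auto)
      (rule conn_Un_overlap[OF f(1)[of "2 ^ h"] assms(8)]; use f(5) assms(6,12) in auto)
  then have "conn (g i)" if "i \<le> 2 ^ h" for i
    using g f(1)[OF that] by metis
  moreover have "g i \<inter> g j = {}" if "i \<le> 2 ^ h" "j \<le> 2 ^ h" "i \<noteq> j" for i j
  proof -
    have *: "g i \<inter> g j = {}" if "i < j" "j \<le> 2 ^ h" for i j
    proof -
      have fij: "f i \<inter> f j = {}"
        using f(2) that by simp
      have fi: "f i \<subseteq> U'" if "i \<noteq> 0"
        using f(8)[of i] \<open>i < j\<close> \<open>j \<le> 2 ^ h\<close> that by simp
      have fj: "f j \<subseteq> U'" if "j \<noteq> 2 ^ h"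
        using f(8)[of j] \<open>i < j\<close> \<open>j \<le> 2 ^ h\<close> that by simp
      have f0: "f 0 \<subseteq> r \<union> P \<union> U'" and f1: "f (2 ^ h) \<subseteq> s \<union> Q \<union> U'"
        using f(6,7) assms(5,6) by blast+
      have d: "(r \<union> P) \<inter> (s \<union> Q) = {}" "(r \<union> P) \<inter> U' = {}" "(s \<union> Q) \<inter> U' = {}"
        using assms(2-4,9,10) by blast+
      show ?thesis
      proof (cases "i = 0"; cases "j = 2 ^ h")
        assume "i = 0" "j = 2 ^ h"
        then show ?thesis
          using fij f0 f1 d g(1,2) by auto
      next
        assume "i = 0" "j \<noteq> 2 ^ h"
        then show ?thesis
          using fij fj d g(1) g(3)[of j] that by auto
      next
        assume "i \<noteq> 0" "j = 2 ^ h"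
        then show ?thesis
          using fij fi d g(2) g(3)[of i] that by auto
      next
        assume "i \<noteq> 0" "j \<noteq> 2 ^ h"
        then show ?thesis
          using fij g(3)[of i] g(3)[of j] that by auto
      qed
    qed
    show ?thesis
      using *[of i j] *[of j i] that by (cases "i < j") auto
  qed
  moreover have "touch (g i) (g j)" if "(i, j) \<in> parcs (nabla h)" for i j
    using touch_mono[OF f(3)[OF that] fg fg] .
  moreover have "r \<subseteq> g 0" "s \<subseteq> g (2 ^ h)"
    using g by auto
  moreover have "g 0 \<subseteq> r \<union> U" "g (2 ^ h) \<subseteq> s \<union> U"
    using g(1,2) f(6,7) assms(2,3,5,6) by blast+
  moreover have "g i \<subseteq> U" if "0 < i" "i < 2 ^ h" for i
    using g(3)[of i] f(8)[OF that] that assms(2) by auto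
  ultimately show ?thesis
    unfolding rooted_nabla_def nabla_model_def by (intro exI[of _ g] conjI) blast+
qed

lemma rooted_nabla_Suc:
  assumes "rooted_nabla h (r \<union> A) M Z" "rooted_nabla h M (s \<union> C) Z'"
    and "A \<union> M \<union> C \<union> Z \<union> Z' \<subseteq> U" "(r \<union> s) \<inter> U = {}" "touch r s" "M \<noteq> {}"
    and "(r \<union> A) \<inter> (s \<union> C) = {}" "(A \<union> C) \<inter> M = {}" "(A \<union> M \<union> C) \<inter> (Z \<union> Z') = {}" "Z \<inter> Z' = {}"
  shows "rooted_nabla (Suc h) r s U"
proof -
  define d :: nat where "d = 2 ^ h"
  have d: "0 < d" "2 ^ h = d" "2 ^ Suc h = 2 * d"
    unfolding d_def by simp_all
  obtain f where "nabla_model h (r \<union> A) M Z f"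
    using assms(1) unfolding rooted_nabla_def by blast
  note f = nabla_modelD[OF this, unfolded d(2)]
  obtain g where "nabla_model h M (s \<union> C) Z' g"
    using assms(2) unfolding rooted_nabla_def by blast
  note g = nabla_modelD[OF this, unfolded d(2)]
  \<comment> \<open>Index \<open>d\<close> is the vertex shared by the two copies:
    \<open>f d\<close> and \<open>g 0\<close> both contain \<open>M\<close>, so their union is
    connected. The new root edge comes from \<open>touch r s\<close>.\<close>
  define F where "F = (\<lambda>i. if i < d then f i else if i = d then f d \<union> g 0 else g (i - d))"
  have F_simps: "\<And>i. i < d \<Longrightarrow> F i = f i" "F d = f d \<union> g 0" "\<And>i. 0 < i \<Longrightarrow> F (i + d) = g i"
    unfolding F_def by auto
  have fF: "f i \<subseteq> F i" if "i \<le> d" for i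
    using that unfolding F_def by auto
  have gF: "g i \<subseteq> F (i + d)" for i
    unfolding F_def by auto
  have fZ: "f i \<subseteq> r \<union> A \<union> Z" if "i < d" for i
    using f(6) f(8)[of i] that by (cases "i = 0") auto
  have gZ: "g i \<subseteq> s \<union> C \<union> Z'" if "0 < i" "i \<le> d" for i
    using g(7) g(8)[of i] that by (cases "i = d") auto
  have "conn (F i)" if "i \<le> 2 * d" for i
  proof -
    have "conn (f d \<union> g 0)"
      using f(1)[of d] g(1)[of 0] f(5) g(4) assms(6) by (intro conn_Un_overlap) auto
    then show ?thesis
      using f(1)[of i] g(1)[of "i - d"] that unfolding F_def by auto
  qed
  moreover have "F i \<inter> F j = {}" if "i \<le> 2 * d" "j \<le> 2 * d" "i \<noteq> j" for i j
  proof -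
    have dis: "(r \<union> A \<union> Z) \<inter> (M \<union> Z') = {}" "(M \<union> Z) \<inter> (s \<union> C \<union> Z') = {}" "(r \<union> A \<union> Z) \<inter> (s \<union> C \<union> Z') = {}"
    proof -
      have "(r \<union> s) \<inter> (A \<union> M \<union> C \<union> Z \<union> Z') = {}"
        using assms(3,4) by blast
      then show "(r \<union> A \<union> Z) \<inter> (M \<union> Z') = {}" "(M \<union> Z) \<inter> (s \<union> C \<union> Z') = {}"
          "(r \<union> A \<union> Z) \<inter> (s \<union> C \<union> Z') = {}"
        using assms(7-10) by (simp_all add: Int_Un_distrib Int_Un_distrib2 Int_commute)
    qed
    have *: "F i \<inter> F j = {}" if ij: "i < j" "j \<le> 2 * d" for i j
    proof -
      consider "j < d" | "i < d" "j = d" | "i < d" "d < j" | "i = d" "d < j" | "d < i"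
        using ij by linarith
      then show ?thesis
      proof cases
        case 1
        then show ?thesis
          using f(2)[of i j] ij F_simps(1) by simp
      next
        case 2
        then show ?thesis
          using f(2)[of i d] fZ[of i] g(6) dis(1) F_simps(1)[of i] F_simps(2) by auto
      next
        case 3
        then have "F j = g (j - d)" "g (j - d) \<subseteq> s \<union> C \<union> Z'"
          using gZ[of "j - d"] ij unfolding F_def by auto
        then show ?thesis
          using fZ[of i] dis(3) F_simps(1)[of i] 3 by auto
      next
        case 4
        then have "F j = g (j - d)" "g (j - d) \<subseteq> s \<union> C \<union> Z'" "g 0 \<inter> g (j - d) = {}"
          using gZ[of "j - d"] g(2)[of 0 "j - d"] ij unfolding F_def by auto
        then show ?thesis
          using f(7) dis(2) F_simps(2) 4 by auto
      next
        case 5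
        then show ?thesis
          using g(2)[of "i - d" "j - d"] ij unfolding F_def by auto
      qed
    qed
    show ?thesis
      using *[of i j] *[of j i] that by (cases "i < j") auto
  qed
  moreover have "touch (F i) (F j)" if "(i, j) \<in> parcs (nabla (Suc h))" for i j
  proof -
    have root: "touch (F 0) (F (2 * d))"
    proof -
      have "r \<subseteq> F 0" "s \<subseteq> F (2 * d)"
        using f(4) g(5) fF[of 0] gF[of d] by (auto simp: mult_2)
      then show ?thesis
        using touch_mono[OF assms(5)] by blast
    qed
    from that consider "(i, j) \<in> parcs (nabla h)"
      | i' j' where "i = i' + d" "j = j' + d" "(i', j') \<in> parcs (nabla h)"
      | "i = 0" "j = 2 * d" | "i = 2 * d" "j = 0"
      unfolding parcs_nabla_Suc d by auto
    then show ?thesis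
    proof cases
      case 1
      then show ?thesis
        using touch_mono[OF f(3)[OF 1]] fF parcs_nabla_bound[OF 1] unfolding d by blast
    next
      case 2
      then show ?thesis
        using touch_mono[OF g(3)[OF 2(3)] gF gF] by simp
    qed (use root touch_commute in auto)
  qed
  moreover have "r \<subseteq> F 0" "F 0 \<subseteq> r \<union> U"
    using f(4,6) assms(3) F_simps(1)[OF d(1)] by auto
  moreover have "s \<subseteq> F (2 * d)" "F (2 * d) \<subseteq> s \<union> U"
    using g(5,7) assms(3) F_simps(3)[OF d(1)] by (auto simp: mult_2)
  moreover have "F i \<subseteq> U" if "0 < i" "i < 2 * d" for i
  proof -
    consider "i < d" | "i = d" | "d < i"
      by linarith
    then show ?thesis
    proof cases
      case 1
      then show ?thesis
        using f(8)[of i] that assms(3) F_simps(1)[of i] by blast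
    next
      case 2
      then show ?thesis
        using f(7) g(6) assms(3) F_simps(2) by blast
    next
      case 3
      then have "F i = g (i - d)" "g (i - d) \<subseteq> Z'"
        using g(8)[of "i - d"] that unfolding F_def by auto
      then show ?thesis
        using assms(3) by blast
    qed
  qed
  ultimately show ?thesis
    unfolding rooted_nabla_def nabla_model_def d by (intro exI[of _ F] conjI) blast+
qed

section \<open>Combining the structures found in the two halves of a step\<close>

lemma state_commute: "state r s U \<longleftrightarrow> state s r U"
  unfolding state_def by (auto simp: touch_commute Un_commute Int_commute)

text \<open>A tree in \<open>Z\<close> lies between \<open>r \<union> A\<close> and
  \<open>M\<close>; the set \<open>M \<union> Z' \<union> C\<close> then links \<open>M\<close> to
  \<open>s\<close>, and symmetrically for \<open>Z'\<close>. If neither half yields a tree, both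
  yield nablas, which are glued at \<open>M\<close>.\<close>

lemma nabla_step_combine:
  assumes "nabla_step r s U Z Z'" "state r s U" "U \<subseteq> V" "Z \<union> Z' \<subseteq> U" "Z \<inter> Z' = {}" "conn Z" "conn Z'"
    and IH: "\<And>r' s' Z\<^sub>0. Z\<^sub>0 \<in> {Z, Z'} \<Longrightarrow> state r' s' Z\<^sub>0 \<Longrightarrow>
      rooted_nabla h r' s' Z\<^sub>0 \<or> rooted_apex_tree i r' s' Z\<^sub>0 \<or> rooted_apex_tree j s' r' Z\<^sub>0"
  shows "rooted_nabla (Suc h) r s U \<or> rooted_apex_tree i r s U \<or> rooted_apex_tree j s r U"
proof -
  obtain A M C where AMC: "A \<union> M \<union> C \<subseteq> U" "(r \<union> A) \<inter> (s \<union> C) = {}" "A \<inter> Z' = {}" "C \<inter> Z = {}"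
    and st: "state (r \<union> A) M Z" "state M (s \<union> C) Z'"
    using assms(1) unfolding nabla_step_def by blast
  have st1: "conn (r \<union> A)" "conn M" "(r \<union> A) \<inter> M = {}" "(r \<union> A \<union> M) \<inter> Z = {}" "touch Z (r \<union> A)" "touch Z M"
    using st(1) unfolding state_def by blast+
  have st2: "conn (s \<union> C)" "M \<inter> (s \<union> C) = {}" "(M \<union> (s \<union> C)) \<inter> Z' = {}" "touch Z' M" "touch Z' (s \<union> C)"
    using st(2) unfolding state_def by blast+
  have st0: "conn r" "conn s" "r \<inter> s = {}" "(r \<union> s) \<inter> U = {}" "touch r s"
    using assms(2) unfolding state_def by blast+
  have ne: "r \<noteq> {}" "s \<noteq> {}" "M \<noteq> {}" "r \<union> A \<noteq> {}" "s \<union> C \<noteq> {}"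
    using st0(1,2) st1(2) conn_nonempty by auto
  have r: "r \<inter> U = {}" "s \<inter> U = {}"
    using st0(4) by blast+
  have "conn ((s \<union> C) \<union> Z' \<union> M)" "conn ((r \<union> A) \<union> Z \<union> M)"
    using st1 st2 assms(6,7) by (intro conn_Un[OF conn_Un]; simp add: touch_commute)+
  then have big: "conn (s \<union> (M \<union> Z' \<union> C))" "conn (r \<union> (A \<union> Z \<union> M))"
    by (simp_all add: Un_ac)
  have d: "M \<inter> Z = {}" "M \<inter> Z' = {}" "A \<inter> Z = {}" "C \<inter> Z' = {}" "A \<inter> M = {}" "M \<inter> C = {}" "A \<inter> C = {}"
    using AMC(2) st1(3,4) st2(2,3) by (simp_all add: Int_Un_distrib Int_Un_distrib2 Int_commute)
  have Z: "Z \<subseteq> U" "Z' \<subseteq> U"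
    using assms(4) by blast+
  have P1: "A \<union> (M \<union> Z' \<union> C) \<subseteq> U - Z" "A \<inter> (M \<union> Z' \<union> C) = {}"
    and P2: "(A \<union> Z \<union> M) \<union> C \<subseteq> U - Z'" "(A \<union> Z \<union> M) \<inter> C = {}"
    using AMC(1,3,4) d assms(4,5) by auto
  have sub: "M \<subseteq> s \<union> (M \<union> Z' \<union> C)" "M \<subseteq> r \<union> (A \<union> Z \<union> M)"
    by blast+
  have P1': "(M \<union> Z' \<union> C) \<union> A \<subseteq> U - Z" "(M \<union> Z' \<union> C) \<inter> A = {}"
    and P2': "C \<union> (A \<union> Z \<union> M) \<subseteq> U - Z'" "C \<inter> (A \<union> Z \<union> M) = {}"
    using P1 P2 by blast+
  consider "rooted_apex_tree i (r \<union> A) M Z" | "rooted_apex_tree j M (r \<union> A) Z"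
    | "rooted_apex_tree i M (s \<union> C) Z'" | "rooted_apex_tree j (s \<union> C) M Z'"
    | "rooted_nabla h (r \<union> A) M Z" "rooted_nabla h M (s \<union> C) Z'"
    using IH[OF _ st(1)] IH[OF _ st(2)] by blast
  then show ?thesis
  proof cases
    case 1
    have "rooted_apex_tree i r s U"
      by (rule rooted_apex_tree_extend[OF 1 Z(1) P1 assms(3) subset_refl sub(1) st1(1) big(1) r(1) ne(1,3)])
    then show ?thesis
      by blast
  next
    case 2
    have "rooted_apex_tree j s r U"
      by (rule rooted_apex_tree_extend[OF 2 Z(1) P1' assms(3) sub(1) subset_refl big(1) st1(1) r(2) ne(2,4)])
    then show ?thesis
      by blast
  next
    case 3
    have "rooted_apex_tree i r s U"
      by (rule rooted_apex_tree_extend[OF 3 Z(2) P2 assms(3) sub(2) subset_refl big(2) st2(1) r(1) ne(1,5)])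
    then show ?thesis
      by blast
  next
    case 4
    have "rooted_apex_tree j s r U"
      by (rule rooted_apex_tree_extend[OF 4 Z(2) P2' assms(3) subset_refl sub(2) st2(1) big(2) r(2) ne(2,3)])
    then show ?thesis
      by blast
  next
    case 5
    have "rooted_nabla (Suc h) r s U"
      by (rule rooted_nabla_Suc[OF 5 _ st0(4,5) ne(3) AMC(2) _ _ assms(5)])
        (use AMC d assms(4) in \<open>simp_all add: Int_Un_distrib Int_Un_distrib2 Int_commute\<close>)
    then show ?thesis
      by blast
  qed
qed

text \<open>Only trees with apex on the side of \<open>s\<close> in both halves gain a level; any
  other structure in one half is passed on unchanged. \<open>P\<close> stands for the nabla and is
  kept abstract so that the lemma also serves with \<open>r\<close> and \<open>s\<close>
  exchanged.\<close>

lemma fan_step_combine: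
  assumes "fan_step r s U Z Z'" "state r s U" "U \<subseteq> V" "Z \<union> Z' \<subseteq> U" "Z \<inter> Z' = {}"
    and IH: "\<And>r' s' Z\<^sub>0. Z\<^sub>0 \<in> {Z, Z'} \<Longrightarrow> state r' s' Z\<^sub>0 \<Longrightarrow>
      P r' s' Z\<^sub>0 \<or> rooted_apex_tree i r' s' Z\<^sub>0 \<or> rooted_apex_tree j s' r' Z\<^sub>0"
  shows "rooted_apex_tree (Suc i) r s U \<or> rooted_apex_tree j s r U \<or>
    (\<exists>X Y Z\<^sub>0. Z\<^sub>0 \<in> {Z, Z'} \<and> P X (s \<union> Y) Z\<^sub>0 \<and> X \<union> Y \<subseteq> U - Z\<^sub>0 \<and> X \<inter> Y = {} \<and>
       conn (r \<union> X) \<and> conn (s \<union> Y) \<and> X \<noteq> {} \<and> s \<union> Y \<noteq> {})"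
proof -
  obtain X Y where XY: "X \<union> Y \<subseteq> U" "touch r X" and st: "state X (s \<union> Y) Z" "state X (s \<union> Y) Z'"
    using assms(1) unfolding fan_step_def by blast
  have st1: "conn X" "conn (s \<union> Y)" "X \<inter> (s \<union> Y) = {}" "(X \<union> (s \<union> Y)) \<inter> Z = {}" "(X \<union> (s \<union> Y)) \<inter> Z' = {}"
    using st unfolding state_def by blast+
  have st0: "conn r" "conn s" "(r \<union> s) \<inter> U = {}"
    using assms(2) unfolding state_def by blast+
  have rX: "conn (r \<union> X)"
    using st0(1) st1(1) XY(2) by (rule conn_Un)
  have ne: "X \<noteq> {}" "s \<union> Y \<noteq> {}" "s \<noteq> {}" "s \<inter> U = {}"
    using st1 st0 conn_nonempty by auto
  have sub: "X \<union> Y \<subseteq> U - Z\<^sub>0" "Y \<union> X \<subseteq> U - Z\<^sub>0" "X \<inter> Y = {}" "Y \<inter> X = {}" "Z\<^sub>0 \<subseteq> U" if "Z\<^sub>0 \<in> {Z, Z'}" for Z\<^sub>0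
    using that XY(1) st1 assms(4) by blast+
  have up: "rooted_apex_tree j s r U" if "rooted_apex_tree j (s \<union> Y) X Z\<^sub>0" and Z\<^sub>0: "Z\<^sub>0 \<in> {Z, Z'}" for Z\<^sub>0
    by (rule rooted_apex_tree_extend[OF that(1) sub(5)[OF Z\<^sub>0] sub(2)[OF Z\<^sub>0] sub(4)[OF Z\<^sub>0] assms(3) subset_refl _
          st1(2) rX ne(4,3,1)]) blast
  consider "rooted_apex_tree i X (s \<union> Y) Z" "rooted_apex_tree i X (s \<union> Y) Z'"
    | Z\<^sub>0 where "Z\<^sub>0 \<in> {Z, Z'}" "rooted_apex_tree j (s \<union> Y) X Z\<^sub>0"
    | Z\<^sub>0 where "Z\<^sub>0 \<in> {Z, Z'}" "P X (s \<union> Y) Z\<^sub>0"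
    using IH[OF _ st(1)] IH[OF _ st(2)] by blast
  then show ?thesis
  proof cases
    case 1
    have "rooted_apex_tree (Suc i) r s U"
      by (rule rooted_apex_tree_Suc[OF 1 refl _ assms(5) _ st1(3,1) _ st1(2) assms(3)])
        (use XY st1 assms(4) in \<open>auto simp: touch_commute\<close>)
    then show ?thesis
      by blast
  next
    case 2
    then show ?thesis
      using up by blast
  next
    case 3
    then show ?thesis
      using sub(1,3)[OF 3(1)] rX st1(2) ne(1,2) by blast
  qed
qed

end

section \<open>Partitions along a binary tree\<close>

locale tree_partition = biconnected E V for E :: "('a \<times> 'a) set" and V +
  fixes B :: "bool list \<Rightarrow> 'a set" and k :: nat
  assumes conn_B: "length n \<le> k \<Longrightarrow> conn (B n)"
    and disjoint_B: "length m \<le> k \<Longrightarrow> length n \<le> k \<Longrightarrow> m \<noteq> n \<Longrightarrow> B m \<inter> B n = {}"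
    and Union_B: "V = (\<Union>n \<in> {n. length n \<le> k}. B n)"
    and touch_B: "length n < k \<Longrightarrow> touch (B n) (B (b # n))"
begin

text \<open>Since the most recent choice comes first, \<open>suffix v n\<close> says that
  \<open>n\<close> is a descendant of \<open>v\<close>.\<close>

definition U :: "bool list \<Rightarrow> 'a set" where
  "U v = (\<Union>n \<in> {n. length n \<le> k \<and> suffix v n}. B n)"

lemma B_nonempty: "length n \<le> k \<Longrightarrow> B n \<noteq> {}"
  using conn_B conn_nonempty by blast

lemma U_Nil: "U [] = V"
  unfolding U_def Union_B by simp

lemma B_subset_U: "length n \<le> k \<Longrightarrow> suffix v n \<Longrightarrow> B n \<subseteq> U v"
  unfolding U_def by blast

lemma U_mono: "suffix v w \<Longrightarrow> U w \<subseteq> U v"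
  unfolding U_def using suffix_order.trans by blast

lemma U_subset_V: "U v \<subseteq> V"
  unfolding U_def Union_B by blast

lemma B_U_disjoint: "length n \<le> k \<Longrightarrow> \<not> suffix v n \<Longrightarrow> B n \<inter> U v = {}"
  unfolding U_def using disjoint_B by fastforce

lemma U_disjoint: "\<not> suffix v w \<Longrightarrow> \<not> suffix w v \<Longrightarrow> U v \<inter> U w = {}"
proof -
  assume *: "\<not> suffix v w" "\<not> suffix w v"
  have "B n \<inter> U w = {}" if "length n \<le> k" "suffix v n" for n
    using B_U_disjoint[OF that(1), of w] that(2) * suffix_same_cases by blast
  then show ?thesis
    unfolding U_def[of v] by blast
qed

text \<open>Every remaining node other than \<open>v\<close> has its parent among the remaining
  nodes, so parent links connect each remaining branch set to \<open>B v\<close>.\<close>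

lemma conn_U_diff:
  assumes "length v \<le> k" "\<And>w. w \<in> N \<Longrightarrow> \<not> suffix w v"
  shows "conn (U v - (\<Union>w \<in> N. U w))"
proof -
  define S where "S = {n. length n \<le> k \<and> suffix v n \<and> (\<forall>w \<in> N. \<not> suffix w n)}"
  have eq: "U v - (\<Union>w \<in> N. U w) = (\<Union>n \<in> S. B n)"
  proof (intro equalityI subsetI)
    fix x assume x: "x \<in> U v - (\<Union>w \<in> N. U w)"
    then obtain n where n: "length n \<le> k" "suffix v n" "x \<in> B n"
      unfolding U_def by blast
    moreover have "\<not> suffix w n" if "w \<in> N" for w
      using x n that B_subset_U by blast
    ultimately show "x \<in> (\<Union>n \<in> S. B n)"
      unfolding S_def by blast
  next
    fix x assume "x \<in> (\<Union>n \<in> S. B n)"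
    then obtain n where n: "length n \<le> k" "suffix v n" "\<forall>w \<in> N. \<not> suffix w n" "x \<in> B n"
      unfolding S_def by blast
    then show "x \<in> U v - (\<Union>w \<in> N. U w)"
      using B_subset_U B_U_disjoint by blast
  qed
  have vS: "v \<in> S"
    unfolding S_def using assms by blast
  obtain x\<^sub>0 where x\<^sub>0: "x\<^sub>0 \<in> B v"
    using B_nonempty assms(1) by blast
  have "\<exists>C. conn C \<and> B v \<subseteq> C \<and> B n \<subseteq> C \<and> C \<subseteq> (\<Union>n \<in> S. B n)" if "n \<in> S" for n
    using that
  proof (induction n)
    case Nil
    then have "v = []"
      unfolding S_def by simp
    then show ?case
      using conn_B[of v] assms(1) vS by (intro exI[of _ "B v"]) auto
  next
    case (Cons b n)
    show ?case
    proof (cases "v = b # n")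
      case True
      then show ?thesis
        using conn_B[of v] assms(1) vS by (intro exI[of _ "B v"]) auto
    next
      case False
      have "n \<in> S"
        using Cons.prems False unfolding S_def by (auto simp: suffix_Cons)
      then obtain C where C: "conn C" "B v \<subseteq> C" "B n \<subseteq> C" "C \<subseteq> (\<Union>n \<in> S. B n)"
        using Cons.IH by blast
      have n: "length (b # n) \<le> k"
        using Cons.prems unfolding S_def by blast
      have "touch C (B (b # n))"
        using touch_B[of n b] n C(3) touch_mono by (metis Suc_le_lessD length_Cons subset_refl)
      then have "conn (C \<union> B (b # n))"
        using C(1) conn_B[OF n] by (intro conn_Un)
      then show ?thesis
        using C Cons.prems by (intro exI[of _ "C \<union> B (b # n)"]) blast
    qed
  qed
  then have "conn (\<Union>n \<in> S. B n)"
    using x\<^sub>0 vS by (intro conn_if_common_point[of x\<^sub>0]) (blast, meson UN_E subsetD)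
  then show ?thesis
    using eq by simp
qed

lemma conn_U: "length v \<le> k \<Longrightarrow> conn (U v)"
  using conn_U_diff[of v "{}"] by simp

lemma conn_compl_U: "v \<noteq> [] \<Longrightarrow> conn (V - U v)"
  using conn_U_diff[of "[]" "{v}"] U_Nil by simp

text \<open>Otherwise contracting \<open>V - U v\<close> to an apex gives an apex tree of height \<open>l\<close>.\<close>

lemma enclosed_descendant:
  assumes "\<not> apex_tree l" "length v + l \<le> k" "v \<noteq> []"
  shows "\<exists>w. suffix v w \<and> length w = length v + l \<and> enclosed (U w) (U v)"
proof (rule ccontr)
  assume neg: "\<not> ?thesis"
  have leaf: "touch (U (xs @ v)) (V - U v)" if "length xs = l" for xs
  proof -
    have "\<not> enclosed (U (xs @ v)) (U v)"
      using neg that suffixI[of "xs @ v" xs v] by (metis add.commute length_append)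
    then show ?thesis
      using E_subset U_mono[of v "xs @ v"] unfolding enclosed_def touch_def suffix_def by blast
  qed
  \<comment> \<open>A leaf takes its whole subtree, as its contact with \<open>V - U v\<close> may
    lie anywhere below it; inner nodes take just their branch sets.\<close>
  define T where "T = (\<lambda>xs. if length xs < l then B (xs @ v) else U (xs @ v))"
  have B_T: "B (xs @ v) \<subseteq> T xs" "T xs \<subseteq> U (xs @ v)" if "length xs \<le> l" for xs
    using that assms(2) B_subset_U[of "xs @ v" "xs @ v"] unfolding T_def by auto
  have disj: "T xs \<inter> T ys = {}" if "length xs \<le> length ys" "length ys \<le> l" "xs \<noteq> ys" for xs ys
  proof (cases "length xs < l")
    case True
    have "\<not> suffix (ys @ v) (xs @ v)"
    proof
      assume suf: "suffix (ys @ v) (xs @ v)"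
      then have "length ys = length xs"
        using suffix_length_le[OF suf] that(1) by simp
      then show False
        using suf that(3) by (auto simp: suffix_def)
    qed
    then have "B (xs @ v) \<inter> U (ys @ v) = {}"
      using that assms(2) by (intro B_U_disjoint) auto
    then show ?thesis
      using True B_T(2)[OF that(2)] unfolding T_def by auto
  next
    case False
    then have "length ys = length xs"
      using that by simp
    then have "U (xs @ v) \<inter> U (ys @ v) = {}"
      using that(3) by (intro U_disjoint) (auto simp: suffix_def)
    then show ?thesis
      using B_T(2)[of xs] B_T(2)[of ys] that by fastforce
  qed
  have "tree_model l T"
    unfolding tree_model_def
  proof (intro conjI allI impI)
    fix xs :: "bool list" assume "length xs \<le> l"
    then show "conn (T xs)" "T xs \<subseteq> V"
      using B_T(2)[of xs] U_subset_V[of "xs @ v"] conn_B[of "xs @ v"] conn_U[of "xs @ v"] assms(2)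
      by (auto simp: T_def)
  next
    fix xs ys :: "bool list" assume "length xs \<le> l \<and> length ys \<le> l \<and> xs \<noteq> ys"
    then show "T xs \<inter> T ys = {}"
      using disj[of xs ys] disj[of ys xs] by (cases "length xs \<le> length ys") auto
  next
    fix b and xs :: "bool list" assume xs: "length xs < l"
    have "touch (B (xs @ v)) (B (b # xs @ v))"
      using xs assms(2) by (intro touch_B) auto
    then show "touch (T xs) (T (b # xs))"
      by (rule touch_mono) (use B_T(1)[of xs] B_T(1)[of "b # xs"] xs in auto)
  qed
  moreover have "T xs \<inter> (V - U v) = {}" if "length xs \<le> l" for xs
    using B_T(2)[OF that] U_mono[of v "xs @ v"] by (auto simp: suffix_def)
  ultimately have "apex_tree l"
    unfolding apex_tree_def using conn_compl_U[OF assms(3)] leaf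
    by (intro exI[of _ T] exI[of _ "V - U v"]) (auto simp: T_def)
  with assms(1) show False
    by blast
qed

text \<open>\<open>fork\<close> is applied to \<open>D\<close> with the subtrees at
  \<open>y1\<close> and \<open>y2\<close>. A fan step is final there; a chain is refined with the
  rings \<open>R1\<close> and \<open>R2\<close>, which passes to the subtrees at \<open>w1\<close>
  and \<open>w2\<close>.\<close>

lemma tree_step:
  assumes "\<not> apex_tree l" "0 < l" "length x + (2 * l + 1) \<le> k" "state r s (U x)"
  shows "\<exists>y z. length y \<le> length x + (2 * l + 1) \<and> length z \<le> length x + (2 * l + 1) \<and>
    U y \<union> U z \<subseteq> U x \<and> U y \<inter> U z = {} \<and>
    (nabla_step r s (U x) (U y) (U z) \<or> fan_step r s (U x) (U y) (U z) \<or> fan_step s r (U x) (U y) (U z))"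
proof -
  obtain y1 where y1: "suffix (False # x) y1" "length y1 = length x + 1 + l" "enclosed (U y1) (U (False # x))"
    using enclosed_descendant[OF assms(1), of "False # x"] assms(3) by auto
  obtain y2 where y2: "suffix (True # x) y2" "length y2 = length x + 1 + l" "enclosed (U y2) (U (True # x))"
    using enclosed_descendant[OF assms(1), of "True # x"] assms(3) by auto
  have "y1 \<noteq> []" "y2 \<noteq> []"
    using y1(1) y2(1) by auto
  then obtain w1 w2 where w1: "suffix y1 w1" "length w1 = length y1 + l" "enclosed (U w1) (U y1)"
    and w2: "suffix y2 w2" "length w2 = length y2 + l" "enclosed (U w2) (U y2)"
    using enclosed_descendant[OF assms(1), of y1] enclosed_descendant[OF assms(1), of y2] assms(3) y1(2) y2(2)
    by auto
  have x: "suffix x y1" "suffix x y2"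
    using y1(1) y2(1) suffix_ConsD by metis+
  have "U (False # x) \<inter> U (True # x) = {}"
    by (intro U_disjoint) (auto simp: suffix_def)
  moreover have sub: "U (False # x) \<subseteq> U x" "U (True # x) \<subseteq> U x" "U y1 \<subseteq> U (False # x)" "U y2 \<subseteq> U (True # x)"
      "U w1 \<subseteq> U y1" "U w2 \<subseteq> U y2"
    using y1 y2 w1 w2 by (auto intro!: U_mono simp: suffix_def)
  ultimately have disj: "U (False # x) \<inter> U y2 = {}" "U (True # x) \<inter> U y1 = {}" "U y1 \<inter> U y2 = {}"
    by blast+
  define D where "D = U x - (U y1 \<union> U y2)"
  define R1 where "R1 = U y1 - U w1"
  define R2 where "R2 = U y2 - U w2"
  have "\<not> suffix y1 x" "\<not> suffix y2 x" "\<not> suffix w1 y1" "\<not> suffix w2 y2"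
    using y1 y2 w1 w2 assms(2) suffix_length_le by fastforce+
  then have conn: "conn D" "conn R1" "conn R2"
    using conn_U_diff[of x "{y1, y2}"] conn_U_diff[of y1 "{w1}"] conn_U_diff[of y2 "{w2}"] assms(3) y1 y2
    unfolding D_def R1_def R2_def by auto
  have U12: "U y1 = R1 \<union> U w1" "U y2 = R2 \<union> U w2"
    using sub unfolding R1_def R2_def by blast+
  have ne: "U y1 \<noteq> {}" "U y2 \<noteq> {}" "U w1 \<noteq> {}" "U w2 \<noteq> {}"
    using conn_U conn_nonempty y1(2) y2(2) w1(2) w2(2) assms(3) by simp_all
  have st: "conn r" "conn s" "r \<inter> s = {}" "(r \<union> s) \<inter> U x = {}" "r \<union> s \<subseteq> V" "touch (U x) r" "touch (U x) s"
      "enclosed (U x) (r \<union> s)"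
    using assms(4) unfolding state_def by blast+
  \<comment> \<open>The outside neighbours of \<open>U y1\<close> stay in the subtree of the child
    \<open>False # x\<close>, which misses \<open>U y2\<close>; hence they lie in \<open>D\<close>.
    Choosing \<open>y1\<close> and \<open>y2\<close> below different children serves this
    purpose.\<close>
  have enc: "enclosed (U y1) D" "enclosed (U y2) D" "enclosed D (U y1 \<union> U y2 \<union> r \<union> s)"
      "enclosed (U w1) R1" "enclosed (U w2) R2"
    using y1(3) y2(3) w1(3) w2(3) st(8) sub disj unfolding enclosed_def D_def R1_def R2_def by blast+
  then have enc': "enclosed R1 (U w1 \<union> D)" "enclosed R2 (U w2 \<union> D)"
    unfolding U12 enclosed_def by blast+
  have Ux: "U x = D \<union> U y1 \<union> U y2"
    using sub unfolding D_def by blast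
  have "\<not> touch (U y1) (r \<union> s)"
    by (rule enclosed_not_touch[OF enc(1)]) (use st(4) Ux in blast)
  moreover have "\<not> touch (U y2) (r \<union> s)"
    by (rule enclosed_not_touch[OF enc(2)]) (use st(4) Ux in blast)
  ultimately have Dt: "touch D r" "touch D s"
    using st(6,7) unfolding Ux by auto
  have d: "D \<inter> (U y1 \<union> U y2) = {}" "(r \<union> s) \<inter> (D \<union> U y1 \<union> U y2) = {}" "D \<union> U y1 \<union> U y2 \<union> r \<union> s \<subseteq> V"
    using st(4,5) U_subset_V Ux unfolding D_def by blast+
  have d12: "R1 \<inter> U w1 = {}" "R2 \<inter> U w2 = {}"
    unfolding R1_def R2_def by blast+
  have ws: "U w1 \<inter> U w2 = {}" "U w1 \<union> U w2 \<subseteq> U x" "U w2 \<inter> U w1 = {}" "U w2 \<union> U w1 \<subseteq> U x"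
    using sub disj by blast+
  have len: "length y1 \<le> length x + (2 * l + 1)" "length y2 \<le> length x + (2 * l + 1)"
      "length w1 \<le> length x + (2 * l + 1)" "length w2 \<le> length x + (2 * l + 1)"
    using y1 y2 w1 w2 by simp_all
  have Dx: "D \<subseteq> U x" "D \<union> R1 \<union> R2 \<subseteq> U x" "D \<union> R2 \<union> R1 \<subseteq> U x"
    using sub unfolding D_def R1_def R2_def by blast+
  from fork[OF st(1,2) conn(1) ne(1,2) enc(1-3) disj(3) st(3) d Dt]
  consider "chain D r (U y1) (U y2) s" | "chain D r (U y2) (U y1) s"
    | "fan_step r s D (U y1) (U y2) \<or> fan_step s r D (U y1) (U y2)"
    by blast
  then show ?thesis
  proof cases
    case 1
    have "nabla_step r s (D \<union> R1 \<union> R2) (U w1) (U w2) \<or> nabla_step r s (D \<union> R1 \<union> R2) (U w2) (U w1) \<or>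
        fan_step r s (D \<union> R1 \<union> R2) (U w1) (U w2) \<or> fan_step s r (D \<union> R1 \<union> R2) (U w2) (U w1)"
      by (rule chain_step[OF 1[unfolded U12] st(1,2) conn(2,3) ne(3,4) enc(4,5) enc' _ _ d12 st(3)])
        (use d disj(3) in \<open>simp_all add: U12 Int_Un_distrib Int_Un_distrib2 Int_commute\<close>)
    then show ?thesis
      using nabla_step_mono[OF _ Dx(2)] nabla_step_mono[OF _ Dx(3)] fan_step_mono[OF _ Dx(2)]
        fan_step_mono[OF _ Dx(3)] len(3,4) ws by blast
  next
    case 2
    have "nabla_step r s (D \<union> R2 \<union> R1) (U w2) (U w1) \<or> nabla_step r s (D \<union> R2 \<union> R1) (U w1) (U w2) \<or>
        fan_step r s (D \<union> R2 \<union> R1) (U w2) (U w1) \<or> fan_step s r (D \<union> R2 \<union> R1) (U w1) (U w2)"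
      by (rule chain_step[OF 2[unfolded U12] st(1,2) conn(3,2) ne(4,3) enc(5,4) enc'(2,1) _ _ d12(2,1) st(3)])
        (use d disj(3) in \<open>simp_all add: U12 Int_Un_distrib Int_Un_distrib2 Int_commute\<close>)
    then show ?thesis
      using nabla_step_mono[OF _ Dx(2)] nabla_step_mono[OF _ Dx(3)] fan_step_mono[OF _ Dx(2)]
        fan_step_mono[OF _ Dx(3)] len(3,4) ws by blast
  next
    case 3
    moreover have "U y1 \<union> U y2 \<subseteq> U x"
      using Ux by blast
    ultimately show ?thesis
      using fan_step_mono[OF _ Dx(1)] len(1,2) disj(3) by blast
  qed
qed

text \<open>The three heights add up instead of multiplying because apex trees found below a nabla step survive
  it: the other half of the step joins the middle set to the root set it is missing.\<close>

lemma rooted_nabla_or_apex_tree: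
  assumes "\<not> apex_tree l" "0 < l" "state r s (U x)" "h + i + j \<le> n + 2" "length x + n * (2 * l + 1) \<le> k"
  shows "rooted_nabla h r s (U x) \<or> rooted_apex_tree i r s (U x) \<or> rooted_apex_tree j s r (U x)"
  using assms(3-)
proof (induction n arbitrary: h i j r s x)
  case (0 h i j r s x)
  have "conn (U x)"
    using 0 by (intro conn_U) simp
  \<comment> \<open>The sum is at most 2, so one target is 0, and a structure of height 0 is present
    in every state.\<close>
  moreover have "h = 0 \<or> i = 0 \<or> j = 0"
    using 0 by linarith
  ultimately show ?case
    using rooted_nabla_0 rooted_apex_tree_0 U_subset_V 0(1) state_commute by blast
next
  case (Suc n h i j r s x)
  show ?case
  proof (cases "h = 0 \<or> i = 0 \<or> j = 0")
    case True
    moreover have "conn (U x)"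
      using Suc.prems by (intro conn_U) simp
    ultimately show ?thesis
      using rooted_nabla_0 rooted_apex_tree_0 U_subset_V Suc.prems(1) state_commute by blast
  next
    case False
    then obtain h' i' j' where hij: "h = Suc h'" "i = Suc i'" "j = Suc j'"
      by (meson not0_implies_Suc)
    have "length x + (2 * l + 1) \<le> k"
      using Suc.prems(3) by simp
    then obtain y z where yz: "length y \<le> length x + (2 * l + 1)" "length z \<le> length x + (2 * l + 1)"
        "U y \<union> U z \<subseteq> U x" "U y \<inter> U z = {}"
        "nabla_step r s (U x) (U y) (U z) \<or> fan_step r s (U x) (U y) (U z) \<or> fan_step s r (U x) (U y) (U z)"
      using tree_step[OF assms(1,2) _ Suc.prems(1)] by blast
    have len: "length y + n * (2 * l + 1) \<le> k" "length z + n * (2 * l + 1) \<le> k"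
      using yz(1,2) Suc.prems(3) by simp_all
    have IH: "rooted_nabla h r' s' Z \<or> rooted_apex_tree i r' s' Z \<or> rooted_apex_tree j s' r' Z"
      if "Z \<in> {U y, U z}" "state r' s' Z" "h + i + j \<le> n + 2" for h i j r' s' Z
      using that Suc.IH[of r' s' y h i j] Suc.IH[of r' s' z h i j] len by blast
    have IH': "rooted_nabla h s' r' Z \<or> rooted_apex_tree j r' s' Z \<or> rooted_apex_tree i s' r' Z"
      if "Z \<in> {U y, U z}" "state r' s' Z" "h + i + j \<le> n + 2" for h i j r' s' Z
      using IH[OF that(1) _ that(3)] that(2) state_commute by blast
    \<comment> \<open>A nabla step raises only the nabla and a fan step only one of the trees, so
      the induction hypothesis is needed with just that one target lowered.\<close>
    have sum: "h' + i + j \<le> n + 2" "h + i' + j \<le> n + 2" "h + i + j' \<le> n + 2"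
      using Suc.prems(2) hij by simp_all
    have s0: "r \<inter> s = {}" "(r \<union> s) \<inter> U x = {}"
      using Suc.prems(1) unfolding state_def by blast+
    from yz(5) show ?thesis
    proof (elim disjE)
      assume *: "nabla_step r s (U x) (U y) (U z)"
      show ?thesis
        unfolding hij(1)
        by (rule nabla_step_combine[OF * Suc.prems(1) U_subset_V yz(3,4)])
          (use len conn_U IH[OF _ _ sum(1)] in auto)
    next
      assume *: "fan_step r s (U x) (U y) (U z)"
      have "rooted_apex_tree (Suc i') r s (U x) \<or> rooted_apex_tree j s r (U x) \<or>
          (\<exists>X Y Z. Z \<in> {U y, U z} \<and> rooted_nabla h X (s \<union> Y) Z \<and> X \<union> Y \<subseteq> U x - Z \<and> X \<inter> Y = {} \<and>
            conn (r \<union> X) \<and> conn (s \<union> Y) \<and> X \<noteq> {} \<and> s \<union> Y \<noteq> {})"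
        by (rule fan_step_combine[OF * Suc.prems(1) U_subset_V yz(3,4)])
          (use IH[OF _ _ sum(2)] in auto)
      then show ?thesis
      proof (elim disjE exE conjE)
        fix X Y Z
        assume Z: "Z \<in> {U y, U z}" and "rooted_nabla h X (s \<union> Y) Z" "X \<union> Y \<subseteq> U x - Z" "X \<inter> Y = {}"
          and c: "conn (r \<union> X)" "conn (s \<union> Y)" "X \<noteq> {}" "s \<union> Y \<noteq> {}"
        then have "rooted_nabla h r s (U x)"
          by (intro rooted_nabla_extend[of h X "s \<union> Y" Z "U x" X Y r s]) (use yz(3) s0 in auto)
        then show ?thesis
          by blast
      qed (use hij in auto)
    next
      assume *: "fan_step s r (U x) (U y) (U z)"
      \<comment> \<open>The step is read with \<open>r\<close> and \<open>s\<close> exchanged,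
        whereas the nabla keeps its orientation; hence the swapped arguments in the instance for
        \<open>P\<close>.\<close>
      have "rooted_apex_tree (Suc j') s r (U x) \<or> rooted_apex_tree i r s (U x) \<or>
          (\<exists>X Y Z. Z \<in> {U y, U z} \<and> rooted_nabla h (r \<union> Y) X Z \<and> X \<union> Y \<subseteq> U x - Z \<and> X \<inter> Y = {} \<and>
            conn (s \<union> X) \<and> conn (r \<union> Y) \<and> X \<noteq> {} \<and> r \<union> Y \<noteq> {})"
        by (rule fan_step_combine[OF * _ U_subset_V yz(3,4), of "\<lambda>r' s'. rooted_nabla h s' r'"])
          (use Suc.prems(1) sum IH'[OF _ _ sum(3)] state_commute in auto)
      then show ?thesis
      proof (elim disjE exE conjE)
        fix X Y Z
        assume Z: "Z \<in> {U y, U z}" and "rooted_nabla h (r \<union> Y) X Z" "X \<union> Y \<subseteq> U x - Z" "X \<inter> Y = {}"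
          and c: "conn (s \<union> X)" "conn (r \<union> Y)" "X \<noteq> {}" "r \<union> Y \<noteq> {}"
        then have "rooted_nabla h r s (U x)"
          by (intro rooted_nabla_extend[of h "r \<union> Y" X Z "U x" Y X r s]) (use yz(3) s0 in auto)
        then show ?thesis
          by blast
      qed (use hij in auto)
    qed
  qed
qed

text \<open>By 2-connectedness \<open>U [False]\<close> touches two distinct vertices
  \<open>c\<close> and \<open>d\<close> of its connected complement, and these grow into a
  bipartition of it.\<close>

lemma initial_state:
  assumes "0 < k"
  shows "\<exists>r s. state r s (U [False])"
proof -
  define W where "W = V - U [False]"
  have conn: "conn (U [False])" "conn W"
    using assms conn_U[of "[False]"] conn_compl_U[of "[False]"] unfolding W_def by simp_all
  have enc: "enclosed (U [False]) W"
    using E_subset unfolding enclosed_def W_def by blast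
  \<comment> \<open>The branch sets of the root and of the other child show that \<open>W\<close>
    has at least two vertices, so something of \<open>W\<close> remains when one vertex is
    deleted.\<close>
  obtain a b where ab: "a \<in> B []" "b \<in> B [True]"
    using B_nonempty[of "[]"] B_nonempty[of "[True]"] assms by auto
  have "B [] \<inter> B [True] = {}" "B [] \<inter> U [False] = {}" "B [True] \<inter> U [False] = {}" "B [] \<subseteq> V" "B [True] \<subseteq> V"
    using disjoint_B[of "[]" "[True]"] B_U_disjoint[of "[]" "[False]"] B_U_disjoint[of "[True]" "[False]"] assms Union_B
    by (auto simp: suffix_Cons)
  then have ab': "a \<noteq> b" "a \<in> V - U [False]" "b \<in> V - U [False]"
    using ab by blast+
  have exit: "touch (U [False]) (W - {t})" if "t \<in> W" for t
  proof -
    have "touch (U [False]) (W - {t} - U [False])"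
      using ab' that
      by (intro exit_enclosed[OF enc conn_nonempty[OF conn(1)] U_subset_V]) (auto simp: W_def)
    then show ?thesis
      by (rule touch_mono) auto
  qed
  have "a \<in> W"
    using ab'(2) unfolding W_def .
  then obtain c where c: "c \<in> W" "touch (U [False]) {c}"
    using exit[of a] unfolding touch_def by blast
  then obtain d where d: "d \<in> W" "d \<noteq> c" "touch (U [False]) {d}"
    using exit[of c] unfolding touch_def by blast
  have fin: "finite W"
    using finite_V unfolding W_def by simp
  obtain r s where rs: "{c} \<subseteq> r" "{d} \<subseteq> s" "conn r" "conn s" "r \<inter> s = {}" "r \<union> s = W"
    using conn_absorb[OF fin conn(2) conn_singleton[of c] conn_singleton[of d]] c d by auto
  have "touch r s"
    by (rule conn_touch[OF conn(2) rs(6,5)]) (use rs in auto)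
  moreover have "touch (U [False]) r" "touch (U [False]) s"
    using touch_mono[OF c(2) subset_refl rs(1)] touch_mono[OF d(3) subset_refl rs(2)] .
  ultimately have "state r s (U [False])"
    unfolding state_def using rs enc W_def by auto
  then show ?thesis
    by blast
qed

lemma apex_tree_or_nabla:
  assumes "0 < l" "(3 * l - 2) * (2 * l + 1) + 1 \<le> k"
  shows "apex_tree l \<or> (\<exists>r s S f. nabla_model l r s S f \<and> r \<union> s \<union> S \<subseteq> V)"
proof (cases "apex_tree l")
  case neg: False
  obtain r s where st: "state r s (U [False])"
    using initial_state assms(2) by auto
  \<comment> \<open>All three targets are \<open>l\<close>, and \<open>3 * l \<le> n + 2\<close>
    holds for \<open>n = 3 * l - 2\<close>. The extra level in the bound on \<open>k\<close> is the
    length of \<open>[False]\<close>.\<close>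
  have "rooted_nabla l r s (U [False]) \<or> rooted_apex_tree l r s (U [False]) \<or> rooted_apex_tree l s r (U [False])"
    by (rule rooted_nabla_or_apex_tree[OF neg assms(1) st, of _ _ _ "3 * l - 2"]) (use assms in auto)
  moreover have "\<not> rooted_apex_tree l r s (U [False])" "\<not> rooted_apex_tree l s r (U [False])"
    using apex_tree_if_rooted U_subset_V st neg unfolding state_def by blast+
  ultimately show ?thesis
    using st U_subset_V unfolding rooted_nabla_def state_def by (metis le_sup_iff)
qed simp

end

section \<open>Minors\<close>

lemma connected_induce_subgraph_iff:
  assumes "pair_graph G" "S \<subseteq> pverts G"
  shows "connected (with_proj G \<restriction> S) \<longleftrightarrow> symmetric_relation.conn (parcs G) S"
proof -
  interpret pair_graph G
    by (rule assms(1))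
  have sym: "sym (parcs G)"
    using pair_sym_arcs unfolding symmetric_def by simp
  interpret symmetric_relation "parcs G"
    by unfold_locales (rule sym)
  have "parcs (mk_symmetric (with_proj G \<restriction> S)) = parcs G \<inter> S \<times> S"
    using sym unfolding mk_symmetric_def induce_subgraph_def sym_def by auto
  moreover have "pverts (mk_symmetric (with_proj G \<restriction> S)) = S"
    unfolding mk_symmetric_def by simp
  ultimately show ?thesis
    unfolding connected_def strongly_connected_def reachable_def conn_iff_rtrancl_on by simp
qed

theorem theorem6p1:
  fixes l k :: nat and G :: "'a pair_pre_digraph"
  assumes "l \<ge> 1"
    and "int k \<ge> 9 * (int l)\<^sup>2 - 3 * int l + 1"
    and "pair_graph G"
    and "k_connected 2 G"
    and "is_minor (binary_tree k) G"
  shows "is_minor (binary_tree_plus l) G \<or> is_minor (nabla l) G"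
proof -
  interpret G: pair_graph G
    by (rule assms(3))
  define V where "V = pverts G"
  define E where "E = parcs G"
  have fin: "finite V"
    unfolding V_def by (rule G.pair_finite_verts)
  interpret symmetric_relation E
    using G.pair_sym_arcs unfolding E_def symmetric_def by unfold_locales simp
  have connected_iff: "connected (with_proj G \<restriction> S) \<longleftrightarrow> conn S" if "S \<subseteq> V" for S
    using connected_induce_subgraph_iff[OF assms(3)] that unfolding V_def E_def .
  have conn_V: "conn V" and conn_delete: "conn (V - {t})" for t
  proof -
    have "conn (V - X)" if "X \<subseteq> V" "card X < 2" for X
      using assms(4) connected_iff[of "V - X"] that unfolding k_connected_def V_def by auto
    from this[of "{}"] this[of "{t}"] show "conn V" "conn (V - {t})"
      by (cases "t \<in> V"; simp)+
  qed
  define N :: "bool list set" where "N = {n. length n \<le> k}"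
  obtain B\<^sub>0 where B\<^sub>0: "minor_model B\<^sub>0 (binary_tree k) G"
    using assms(5) unfolding is_minor_def by blast
  have B\<^sub>0_conn: "conn (B\<^sub>0 n) \<and> B\<^sub>0 n \<subseteq> V" if "n \<in> N" for n
    using B\<^sub>0 that connected_iff[of "B\<^sub>0 n"] unfolding minor_model_def binary_tree_def N_def V_def by auto
  have B\<^sub>0_touch: "touch (B\<^sub>0 n) (B\<^sub>0 (b # n))" if "length n < k" for n b
  proof -
    have "(n, b # n) \<in> parcs (binary_tree k)"
      using that unfolding binary_tree_def by auto
    then show ?thesis
      using B\<^sub>0 unfolding minor_model_def touch_def unfolding E_def by fast
  qed
  have "disjoint_family_on B\<^sub>0 N" "N \<noteq> {}"
    using B\<^sub>0 unfolding minor_model_def binary_tree_def N_def by (auto intro: exI[of _ "[]"])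
  from extend_to_partition[OF fin conn_V this(2) B\<^sub>0_conn this(1)]
  obtain B where B: "\<forall>n \<in> N. B\<^sub>0 n \<subseteq> B n \<and> conn (B n)" "disjoint_family_on B N" "(\<Union>n \<in> N. B n) = V"
    by blast
  have "E \<subseteq> V \<times> V"
    using G.in_arcsD1 G.in_arcsD2 unfolding E_def V_def by auto
  then interpret tree_partition E V B k
  proof unfold_locales
    fix n :: "bool list" and b assume n: "length n < k"
    then have "B\<^sub>0 n \<subseteq> B n" "B\<^sub>0 (b # n) \<subseteq> B (b # n)"
      using B(1) unfolding N_def by auto
    then show "touch (B n) (B (b # n))"
      by (rule touch_mono[OF B\<^sub>0_touch[OF n]])
  qed (use fin conn_delete B in \<open>auto simp: N_def disjoint_family_on_def\<close>)
  \<comment> \<open>The left-hand side is \<open>6 * l^2 - l - 1\<close>, which is at most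
    \<open>9 * l^2 - 3 * l + 1\<close>. Writing \<open>l = Suc m\<close> removes the truncated
    subtraction.\<close>
  have "(3 * l - 2) * (2 * l + 1) + 1 \<le> k"
  proof -
    obtain m where m: "l = Suc m"
      using assms(1) by (cases l) auto
    have "int ((3 * m + 1) * (2 * m + 3) + 1) \<le> 9 * (int (Suc m))\<^sup>2 - 3 * int (Suc m) + 1"
      by (simp add: power2_eq_square algebra_simps)
    then have "int ((3 * m + 1) * (2 * m + 3) + 1) \<le> int k"
      using assms(2) unfolding m by linarith
    moreover have "3 * l - 2 = 3 * m + 1" "2 * l + 1 = 2 * m + 3"
      unfolding m by simp_all
    ultimately show ?thesis
      by (simp only: of_nat_le_iff)
  qed
  then have "apex_tree l \<or> (\<exists>r s S f. nabla_model l r s S f \<and> r \<union> s \<union> S \<subseteq> V)"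
    using assms(1) by (intro apex_tree_or_nabla) simp_all
  then show ?thesis
  proof
    assume "apex_tree l"
    then obtain T Z where T: "tree_model l T" and Z: "conn Z" "Z \<subseteq> V"
        "\<And>xs. length xs \<le> l \<Longrightarrow> T xs \<inter> Z = {}" "\<And>xs. length xs = l \<Longrightarrow> touch (T xs) Z"
      unfolding apex_tree_def by blast
    have T': "\<And>xs. length xs \<le> l \<Longrightarrow> conn (T xs) \<and> T xs \<subseteq> V"
        "\<And>xs ys. length xs \<le> l \<Longrightarrow> length ys \<le> l \<Longrightarrow> xs \<noteq> ys \<Longrightarrow> T xs \<inter> T ys = {}"
        "\<And>b xs. length xs < l \<Longrightarrow> touch (T xs) (T (b # xs))"
      using T unfolding tree_model_def by blast+
    define F where "F = case_option Z T"
    have F: "F None = Z" "F (Some xs) = T xs" for xs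
      unfolding F_def by simp_all
    have "minor_model F (binary_tree_plus l) G"
      unfolding minor_model_def
    proof (intro conjI ballI)
      fix v assume "v \<in> pverts (binary_tree_plus l)"
      then have "F v \<subseteq> V \<and> conn (F v)"
        using T'(1) Z(1,2) by (cases v) (simp_all add: binary_tree_plus_def binary_tree_def F image_iff)
      then show "F v \<subseteq> pverts G" "connected (with_proj G \<restriction> F v)"
        using connected_iff unfolding V_def by auto
    next
      show "disjoint_family_on F (pverts (binary_tree_plus l))"
        unfolding disjoint_family_on_def
      proof (intro ballI impI)
        fix u v assume "u \<in> pverts (binary_tree_plus l)" "v \<in> pverts (binary_tree_plus l)" "u \<noteq> v"
        then show "F u \<inter> F v = {}"
          using T'(2) Z(3)
          by (cases u; cases v) (simp_all add: binary_tree_plus_def binary_tree_def F image_iff Int_commute)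
      qed
    next
      fix e assume "e \<in> parcs (binary_tree_plus l)"
      then obtain u v where e: "e = (u, v)" "(u, v) \<in> parcs (binary_tree_plus l)"
        by (cases e) auto
      from e(2) consider xs b where "length xs < l" "(u, v) = (Some xs, Some (b # xs)) \<or> (u, v) = (Some (b # xs), Some xs)"
        | xs where "length xs = l" "(u, v) = (Some xs, None) \<or> (u, v) = (None, Some xs)"
        unfolding binary_tree_plus_def binary_tree_def binary_tree_leaves_def by (auto simp: Suc_le_eq)
      then have "touch (F u) (F v)"
        using T'(3) Z(4) touch_commute by cases (auto simp: F)
      then show "case e of (u, v) \<Rightarrow> \<exists>x \<in> F u. \<exists>y \<in> F v. (x, y) \<in> parcs G"
        unfolding touch_def e unfolding E_def by simp
    qed
    then show ?thesis
      unfolding is_minor_def by blast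
  next
    assume "\<exists>r s S f. nabla_model l r s S f \<and> r \<union> s \<union> S \<subseteq> V"
    then obtain r s S f where "nabla_model l r s S f" and sub: "r \<union> s \<union> S \<subseteq> V"
      by blast
    note f = nabla_modelD[OF this(1)]
    have "f i \<subseteq> V" if i: "i \<le> 2 ^ l" for i
    proof -
      consider "i = 0" | "i = 2 ^ l" | "0 < i" "i < 2 ^ l"
        using i by linarith
      then show ?thesis
        using f(6,7) f(8)[of i] sub by cases blast+
    qed
    then have "minor_model f (nabla l) G"
      using f(1-3) connected_iff
      unfolding minor_model_def pverts_nabla disjoint_family_on_def touch_def
      unfolding V_def E_def by fastforce
    then show ?thesis
      unfolding is_minor_def by blast
  qed
qed

end
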